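(* Let $G$ be a group. Then the group $\mathfrak{X}(G)$ is finitely presented if and only if $G$ is finitely presented.
   Context: For a group $G$, let $\overline{G}$ be a second copy of $G$ with a fixed isomorphism $g\mapsto\overline{g}$ from $G$ to $\overline{G}$. The group $\mathfrak{X}(G)$ is the quotient of the free product $G\ast\overline{G}$ by the normal closure of the set $\{[g,\overline{g}] : g\in G\}$. *)

theory Defs
  imports "HOL-Algebra.Coset"
begin

section \<open>Quotients of word monoids\<close>

text \<open>The congruence on the free monoid of words over the alphabet \<open>A\<close> generated by the pairs
  in \<open>R\<close>.\<close>

inductive_set word_cong :: "'x set \<Rightarrow> ('x list \<times> 'x list) set \<Rightarrow> ('x list \<times> 'x list) set"
  for A R where
  refl: "w \<in> lists A \<Longrightarrow> (w, w) \<in> word_cong A R"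
| sym: "(v, w) \<in> word_cong A R \<Longrightarrow> (w, v) \<in> word_cong A R"
| trans: "(u, v) \<in> word_cong A R \<Longrightarrow> (v, w) \<in> word_cong A R \<Longrightarrow> (u, w) \<in> word_cong A R"
| step: "(l, r) \<in> R \<Longrightarrow> l \<in> lists A \<Longrightarrow> r \<in> lists A \<Longrightarrow> u \<in> lists A \<Longrightarrow> v \<in> lists A \<Longrightarrow>
    (u @ l @ v, u @ r @ v) \<in> word_cong A R"

definition word_quotient :: "'x set \<Rightarrow> ('x list \<times> 'x list) set \<Rightarrow> 'x list set monoid" where
  "word_quotient A R =
    \<lparr>carrier = lists A // word_cong A R,
     mult = (\<lambda>U V. \<Union>u\<in>U. \<Union>v\<in>V. word_cong A R `` {u @ v}),
     one = word_cong A R `` {[]}\<rparr>"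

lemma word_cong_in_lists:
  "(u, v) \<in> word_cong A R \<Longrightarrow> u \<in> lists A \<and> v \<in> lists A"
  by (induction rule: word_cong.induct) auto

lemma equiv_word_cong: "equiv (lists A) (word_cong A R)"
proof (rule equivI)
  show "word_cong A R \<subseteq> lists A \<times> lists A"
    using word_cong_in_lists by fast
  show "refl_on (lists A) (word_cong A R)"
    by (rule refl_onI) (rule word_cong.refl)
  show "sym (word_cong A R)"
    by (rule symI) (rule word_cong.sym)
  show "trans (word_cong A R)"
    by (rule transI) (rule word_cong.trans)
qed

lemma word_cong_append_left:
  "(u, v) \<in> word_cong A R \<Longrightarrow> w \<in> lists A \<Longrightarrow> (w @ u, w @ v) \<in> word_cong A R"
proof (induction rule: word_cong.induct)
  case (step l r u v)
  then show ?case using word_cong.step[of l r R A "w @ u" v] by simp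
next
  case (refl u)
  then show ?case by (simp add: word_cong.refl)
qed (blast intro: word_cong.sym word_cong.trans)+

lemma word_cong_append_right:
  "(u, v) \<in> word_cong A R \<Longrightarrow> w \<in> lists A \<Longrightarrow> (u @ w, v @ w) \<in> word_cong A R"
proof (induction rule: word_cong.induct)
  case (step l r u v)
  then show ?case using word_cong.step[of l r R A u "v @ w"] by simp
next
  case (refl u)
  then show ?case by (simp add: word_cong.refl)
qed (blast intro: word_cong.sym word_cong.trans)+

lemma word_cong_append:
  assumes "(u, u') \<in> word_cong A R" "(v, v') \<in> word_cong A R"
  shows "(u @ v, u' @ v') \<in> word_cong A R"
  using word_cong_append_right[OF assms(1)] word_cong_append_left[OF assms(2)] assms
  by (meson word_cong.trans word_cong_in_lists)

lemma word_quotient_mult: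
  assumes "u \<in> lists A" "v \<in> lists A"
  shows "word_cong A R `` {u} \<otimes>\<^bsub>word_quotient A R\<^esub> word_cong A R `` {v}
    = word_cong A R `` {u @ v}"
  unfolding word_quotient_def
  by (simp, rule UN_equiv_class2[OF equiv_word_cong equiv_word_cong _ assms])
     (auto simp: congruent2_def intro!: equiv_class_eq[OF equiv_word_cong] word_cong_append)

lemma word_quotient_group:
  assumes inv: "\<And>a. a \<in> A \<Longrightarrow> \<exists>b\<in>A. ([b, a], []) \<in> word_cong A R"
  shows "group (word_quotient A R)"
proof (rule groupI)
  let ?W = "word_quotient A R"
  have car: "\<exists>u\<in>lists A. x = word_cong A R `` {u}" if "x \<in> carrier ?W" for x
    using that by (auto simp: word_quotient_def quotient_def)
  have cls: "word_cong A R `` {u} \<in> carrier ?W" if "u \<in> lists A" for u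
    using that by (auto simp: word_quotient_def quotient_def)
  have one: "\<one>\<^bsub>?W\<^esub> = word_cong A R `` {[]}" by (simp add: word_quotient_def)
  show "\<one>\<^bsub>?W\<^esub> \<in> carrier ?W" by (simp add: one cls)
  show "x \<otimes>\<^bsub>?W\<^esub> y \<in> carrier ?W" if "x \<in> carrier ?W" "y \<in> carrier ?W" for x y
  proof -
    from that[THEN car] obtain u v where "u \<in> lists A" "x = word_cong A R `` {u}"
      "v \<in> lists A" "y = word_cong A R `` {v}" by blast
    then show ?thesis by (simp only: word_quotient_mult cls append_in_lists_conv simp_thms)
  qed
  show "x \<otimes>\<^bsub>?W\<^esub> y \<otimes>\<^bsub>?W\<^esub> z = x \<otimes>\<^bsub>?W\<^esub> (y \<otimes>\<^bsub>?W\<^esub> z)"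
    if "x \<in> carrier ?W" "y \<in> carrier ?W" "z \<in> carrier ?W" for x y z
  proof -
    from that[THEN car] obtain u v w where "u \<in> lists A" "x = word_cong A R `` {u}"
      "v \<in> lists A" "y = word_cong A R `` {v}" "w \<in> lists A" "z = word_cong A R `` {w}"
      by blast
    then show ?thesis
      by (simp only: word_quotient_mult append_in_lists_conv simp_thms append_assoc)
  qed
  show "\<one>\<^bsub>?W\<^esub> \<otimes>\<^bsub>?W\<^esub> x = x" if "x \<in> carrier ?W" for x
    using car[OF that] word_quotient_mult[of "[]" A _ R] by (force simp: one)
  have linv: "\<exists>v\<in>lists A. (v @ u, []) \<in> word_cong A R" if "u \<in> lists A" for u
    using that
  proof (induction u)
    case Nil
    then show ?case by (auto intro!: bexI[of _ "[]"] word_cong.refl)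
  next
    case (Cons a u)
    then obtain v b where v: "v \<in> lists A" "(v @ u, []) \<in> word_cong A R"
      and b: "b \<in> A" "([b, a], []) \<in> word_cong A R" using inv by blast
    have "(v @ [b, a] @ u, v @ [] @ u) \<in> word_cong A R"
      using b v Cons by (intro word_cong_append word_cong.refl) auto
    then have "((v @ [b]) @ a # u, []) \<in> word_cong A R"
      using v(2) by (auto intro: word_cong.trans)
    then show ?case using v b by (intro bexI[of _ "v @ [b]"]) auto
  qed
  show "\<exists>y\<in>carrier ?W. y \<otimes>\<^bsub>?W\<^esub> x = \<one>\<^bsub>?W\<^esub>" if "x \<in> carrier ?W" for x
  proof -
    from car[OF that] obtain u where u: "u \<in> lists A" "x = word_cong A R `` {u}" by auto
    from linv[OF u(1)] obtain v where v: "v \<in> lists A" "(v @ u, []) \<in> word_cong A R" by auto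
    then show ?thesis
      using u word_quotient_mult[of v A u R] equiv_class_eq[OF equiv_word_cong v(2)] cls[OF v(1)]
      by (auto simp: one simp del: in_lists_conv_set
          intro!: bexI[of _ "word_cong A R `` {v}"])
  qed
qed


section \<open>Free groups and free products\<close>

text \<open>The letter \<open>(x, True)\<close> stands for the generator \<open>x\<close> and \<open>(x, False)\<close> for its formal
  inverse.\<close>

definition free_group :: "'x set \<Rightarrow> ('x \<times> bool) list set monoid" where
  "free_group X = word_quotient (X \<times> UNIV) {([(x, b), (x, \<not> b)], []) | x b. x \<in> X}"

lemma free_group_is_group: "group (free_group X)"
  unfolding free_group_def
proof (rule word_quotient_group)
  let ?A = "X \<times> (UNIV :: bool set)" and ?R = "{([(x, b), (x, \<not> b)], []) | x b. x \<in> X}"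
  fix a assume "a \<in> ?A"
  then obtain x b where a: "a = (x, b)" "x \<in> X" by auto
  have "([] @ [(x, \<not> b), (x, \<not> \<not> b)] @ [], [] @ [] @ []) \<in> word_cong ?A ?R"
    by (rule word_cong.step) (use a in \<open>auto; fail\<close>)+
  then show "\<exists>c\<in>?A. ([c, a], []) \<in> word_cong ?A ?R"
    using a by (intro bexI[of _ "(x, \<not> b)"]) auto
qed

text \<open>Words in the disjoint union of the two carriers, modulo multiplying adjacent letters from
  the same factor and deleting identities.\<close>

definition free_product_rels ::
  "('a, 'm) monoid_scheme \<Rightarrow> ('b, 'n) monoid_scheme \<Rightarrow> (('a + 'b) list \<times> ('a + 'b) list) set" where
  "free_product_rels G H =
    {([Inl x, Inl y], [Inl (x \<otimes>\<^bsub>G\<^esub> y)]) | x y. x \<in> carrier G \<and> y \<in> carrier G}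
    \<union> {([Inr x, Inr y], [Inr (x \<otimes>\<^bsub>H\<^esub> y)]) | x y. x \<in> carrier H \<and> y \<in> carrier H}
    \<union> {([Inl \<one>\<^bsub>G\<^esub>], []), ([Inr \<one>\<^bsub>H\<^esub>], [])}"

definition free_product ::
  "('a, 'm) monoid_scheme \<Rightarrow> ('b, 'n) monoid_scheme \<Rightarrow> ('a + 'b) list set monoid" where
  "free_product G H = word_quotient (carrier G <+> carrier H) (free_product_rels G H)"

definition free_product_inl ::
  "('a, 'm) monoid_scheme \<Rightarrow> ('b, 'n) monoid_scheme \<Rightarrow> 'a \<Rightarrow> ('a + 'b) list set" where
  "free_product_inl G H g =
    word_cong (carrier G <+> carrier H) (free_product_rels G H) `` {[Inl g]}"

definition free_product_inr ::
  "('a, 'm) monoid_scheme \<Rightarrow> ('b, 'n) monoid_scheme \<Rightarrow> 'b \<Rightarrow> ('a + 'b) list set" where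
  "free_product_inr G H h =
    word_cong (carrier G <+> carrier H) (free_product_rels G H) `` {[Inr h]}"

lemma word_cong_basic:
  "(l, r) \<in> R \<Longrightarrow> l \<in> lists A \<Longrightarrow> r \<in> lists A \<Longrightarrow> (l, r) \<in> word_cong A R"
  using word_cong.step[of l r R A "[]" "[]"] by simp

lemma free_product_is_group:
  assumes "group G" "group H"
  shows "group (free_product G H)"
  unfolding free_product_def
proof (rule word_quotient_group)
  interpret G: group G by fact
  interpret H: group H by fact
  let ?A = "carrier G <+> carrier H" and ?R = "free_product_rels G H"
  fix a assume "a \<in> ?A"
  then consider g where "a = Inl g" "g \<in> carrier G" | h where "a = Inr h" "h \<in> carrier H"
    by auto
  then show "\<exists>b\<in>?A. ([b, a], []) \<in> word_cong ?A ?R"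
  proof cases
    case 1
    have "([Inl (inv\<^bsub>G\<^esub> g), Inl g], [Inl (inv\<^bsub>G\<^esub> g \<otimes>\<^bsub>G\<^esub> g)]) \<in> ?R"
      unfolding free_product_rels_def using 1 G.inv_closed by blast
    then have "([Inl (inv\<^bsub>G\<^esub> g), Inl g], [Inl \<one>\<^bsub>G\<^esub>]) \<in> word_cong ?A ?R"
      using 1 by (intro word_cong_basic) auto
    moreover have "([Inl \<one>\<^bsub>G\<^esub>], []) \<in> word_cong ?A ?R"
      by (rule word_cong_basic) (auto simp: free_product_rels_def)
    ultimately show ?thesis
      using 1 by (intro bexI[of _ "Inl (inv\<^bsub>G\<^esub> g)"]) (auto intro: word_cong.trans)
  next
    case 2
    have "([Inr (inv\<^bsub>H\<^esub> h), Inr h], [Inr (inv\<^bsub>H\<^esub> h \<otimes>\<^bsub>H\<^esub> h)]) \<in> ?R"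
      unfolding free_product_rels_def using 2 H.inv_closed by blast
    then have "([Inr (inv\<^bsub>H\<^esub> h), Inr h], [Inr \<one>\<^bsub>H\<^esub>]) \<in> word_cong ?A ?R"
      using 2 by (intro word_cong_basic) auto
    moreover have "([Inr \<one>\<^bsub>H\<^esub>], []) \<in> word_cong ?A ?R"
      by (rule word_cong_basic) (auto simp: free_product_rels_def)
    ultimately show ?thesis
      using 2 by (intro bexI[of _ "Inr (inv\<^bsub>H\<^esub> h)"]) (auto intro: word_cong.trans)
  qed
qed

lemma free_product_inl_hom:
  assumes "group G"
  shows "free_product_inl G H \<in> hom G (free_product G H)"
proof (rule homI)
  interpret G: group G by fact
  let ?A = "carrier G <+> carrier H" and ?R = "free_product_rels G H"
  show "free_product_inl G H x \<in> carrier (free_product G H)" if "x \<in> carrier G" for x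
    using that
    by (auto simp: free_product_inl_def free_product_def word_quotient_def intro!: quotientI)
  fix x y assume xy: "x \<in> carrier G" "y \<in> carrier G"
  then have "([Inl x, Inl y], [Inl (x \<otimes>\<^bsub>G\<^esub> y)]) \<in> word_cong ?A ?R"
    by (intro word_cong_basic) (auto simp: free_product_rels_def)
  then show "free_product_inl G H (x \<otimes>\<^bsub>G\<^esub> y)
      = free_product_inl G H x \<otimes>\<^bsub>free_product G H\<^esub> free_product_inl G H y"
    using xy word_quotient_mult[of "[Inl x]" ?A "[Inl y]" ?R]
    by (auto simp: free_product_inl_def free_product_def dest: equiv_class_eq[OF equiv_word_cong])
qed

lemma free_product_inr_hom:
  assumes "group H"
  shows "free_product_inr G H \<in> hom H (free_product G H)"
proof (rule homI)
  interpret H: group H by fact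
  let ?A = "carrier G <+> carrier H" and ?R = "free_product_rels G H"
  show "free_product_inr G H x \<in> carrier (free_product G H)" if "x \<in> carrier H" for x
    using that
    by (auto simp: free_product_inr_def free_product_def word_quotient_def intro!: quotientI)
  fix x y assume xy: "x \<in> carrier H" "y \<in> carrier H"
  then have "([Inr x, Inr y], [Inr (x \<otimes>\<^bsub>H\<^esub> y)]) \<in> word_cong ?A ?R"
    by (intro word_cong_basic) (auto simp: free_product_rels_def)
  then show "free_product_inr G H (x \<otimes>\<^bsub>H\<^esub> y)
      = free_product_inr G H x \<otimes>\<^bsub>free_product G H\<^esub> free_product_inr G H y"
    using xy word_quotient_mult[of "[Inr x]" ?A "[Inr y]" ?R]
    by (auto simp: free_product_inr_def free_product_def dest: equiv_class_eq[OF equiv_word_cong])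
qed


section \<open>Normal closures and finite presentability\<close>

definition normal_closure :: "('a, 'm) monoid_scheme \<Rightarrow> 'a set \<Rightarrow> 'a set" where
  "normal_closure G S = \<Inter>{N. N \<lhd> G \<and> S \<subseteq> N}"

lemma normal_closure_normal:
  assumes "group G" "S \<subseteq> carrier G"
  shows "normal_closure G S \<lhd> G"
proof -
  interpret group G by fact
  let ?F = "{N. N \<lhd> G \<and> S \<subseteq> N}"
  have "carrier G \<lhd> G"
    by (simp add: normal_inv_iff subgroup_self)
  then have "carrier G \<in> ?F" using assms by simp
  then have "subgroup (\<Inter>?F) G"
    by (intro subgroups_Inter) (auto dest: normal_imp_subgroup)
  then show ?thesis
    unfolding normal_closure_def normal_inv_iff
    by (auto intro: normal.inv_op_closed2)
qed

text \<open>Up to a bijection of the generators, every finite set of generators is a finite set of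
  natural numbers.\<close>

definition finitely_presented :: "('a, 'm) monoid_scheme \<Rightarrow> bool" where
  "finitely_presented G \<longleftrightarrow>
    (\<exists>(X :: nat set) R. finite X \<and> finite R \<and> R \<subseteq> carrier (free_group X) \<and>
      G \<cong> free_group X Mod normal_closure (free_group X) R)"


section \<open>The weak commutativity construction\<close>

definition commutator :: "('a, 'm) monoid_scheme \<Rightarrow> 'a \<Rightarrow> 'a \<Rightarrow> 'a" where
  "commutator G x y = x \<otimes>\<^bsub>G\<^esub> y \<otimes>\<^bsub>G\<^esub> inv\<^bsub>G\<^esub> x \<otimes>\<^bsub>G\<^esub> inv\<^bsub>G\<^esub> y"

text \<open>The second factor of \<open>free_product G G\<close> is the copy of \<open>G\<close>: if \<open>g\<close> stands for
  \<open>free_product_inl G G g\<close>, then its image under the fixed isomorphism onto the copy is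
  \<open>free_product_inr G G g\<close>.\<close>

definition weak_commutativity_group ::
  "('a, 'm) monoid_scheme \<Rightarrow> ('a + 'a) list set set monoid" where
  "weak_commutativity_group G =
    free_product G G Mod normal_closure (free_product G G)
      {commutator (free_product G G) (free_product_inl G G g) (free_product_inr G G g) | g.
        g \<in> carrier G}"

end

theory Submission
  imports Defs
begin

text \<open>Since \<open>G\<close> is a retract of \<open>X(G)\<close>, finite presentability passes from \<open>X(G)\<close> to \<open>G\<close>.

  Conversely, let \<open>m\<close> be the size of a finite symmetric generating set of \<open>G\<close>. The relations
  \<open>[w, w'] = 1\<close> for words \<open>w\<close> of length at most \<open>2 m + 2\<close> imply all the others, by induction on the
  length; here \<open>g'\<close> is the copy of \<open>g\<close>. For commuting pairs \<open>(g, g')\<close> and \<open>(h, h')\<close>, the relation for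
  \<open>g h\<close> says that \<open>c(g, h) = g\<^sup>-\<^sup>1 h' g h'\<^sup>-\<^sup>1\<close> is symmetric under exchanging the two copies.
  Expanding \<open>c(g k, h)\<close> shows that, given the relations for shorter words, the relation for \<open>g k h\<close>
  says that \<open>c(g, h)\<close> commutes with \<open>l(k) = k\<^sup>-\<^sup>1 k'\<close>. On the other hand the relation for
  \<open>b a\<^sup>-\<^sup>1\<close> says \<open>l(b a\<^sup>-\<^sup>1 b) = l(b) l(a)\<^sup>-\<^sup>1 l(b)\<close>, and every word \<open>k\<close> of length \<open>m + 1\<close> repeats a
  letter and hence has the form \<open>b a\<^sup>-\<^sup>1 b\<close> with shorter \<open>a\<close> and \<open>b\<close>. So \<open>l(k)\<close> is a product of
  elements already known to commute with \<open>c(g, h)\<close>.\<close>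

section \<open>A criterion for commuting homomorphisms\<close>

definition list_prod :: "('a, 'm) monoid_scheme \<Rightarrow> 'a list \<Rightarrow> 'a" where
  "list_prod G ws = foldr (mult G) ws \<one>\<^bsub>G\<^esub>"

lemma list_prod_Nil [simp]: "list_prod G [] = \<one>\<^bsub>G\<^esub>"
  by (simp add: list_prod_def)

lemma list_prod_Cons [simp]: "list_prod G (a # ws) = a \<otimes>\<^bsub>G\<^esub> list_prod G ws"
  by (simp add: list_prod_def)

text \<open>There are no formal inverses, so for an inverse-closed \<open>A\<close> inside a group
  this is the ball of radius \<open>n\<close> about the identity in the Cayley graph of the subgroup
  generated by \<open>A\<close>.\<close>

definition word_ball :: "('a, 'm) monoid_scheme \<Rightarrow> 'a set \<Rightarrow> nat \<Rightarrow> 'a set" where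
  "word_ball G A n = list_prod G ` {ws. set ws \<subseteq> A \<and> length ws \<le> n}"

lemma finite_word_ball: "finite A \<Longrightarrow> finite (word_ball G A n)"
  unfolding word_ball_def by (intro finite_imageI finite_lists_length_le)

lemma word_ballI: "set ws \<subseteq> A \<Longrightarrow> length ws \<le> n \<Longrightarrow> list_prod G ws \<in> word_ball G A n"
  by (auto simp: word_ball_def)

lemma word_ballE:
  assumes "x \<in> word_ball G A n"
  obtains ws where "x = list_prod G ws" "set ws \<subseteq> A" "length ws \<le> n"
  using assms by (auto simp: word_ball_def)

lemma word_ball_mono: "m \<le> n \<Longrightarrow> word_ball G A m \<subseteq> word_ball G A n"
  by (auto simp: word_ball_def)

section \<open>Identities for commuting elements and for products of words\<close>

context group
begin

lemma inv_mult_cancel [simp]: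
  "x \<in> carrier G \<Longrightarrow> y \<in> carrier G \<Longrightarrow> inv x \<otimes> (x \<otimes> y) = y"
  by (simp add: m_assoc [symmetric])

lemma mult_inv_cancel [simp]:
  "x \<in> carrier G \<Longrightarrow> y \<in> carrier G \<Longrightarrow> x \<otimes> (inv x \<otimes> y) = y"
  by (simp add: m_assoc [symmetric])

lemma commute_mult:
  assumes "x \<in> carrier G" "y \<in> carrier G" "z \<in> carrier G"
    and "x \<otimes> y = y \<otimes> x" "x \<otimes> z = z \<otimes> x"
  shows "x \<otimes> (y \<otimes> z) = (y \<otimes> z) \<otimes> x"
  using assms by (metis m_assoc)

lemma commute_inv:
  assumes "x \<in> carrier G" "y \<in> carrier G" "x \<otimes> y = y \<otimes> x"
  shows "x \<otimes> inv y = inv y \<otimes> x"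
  using assms by (metis inv_closed inv_solve_left inv_solve_right m_assoc m_closed)

text \<open>Multiplying the first equation by \<open>k'\<close> on the left and by
  \<open>inv k\<close> on the right turns it into commutation of \<open>c\<close> with
  \<open>k' \<otimes> inv k\<close>, which equals \<open>inv k \<otimes> k'\<close> because
  \<open>k\<close> and \<open>k'\<close> commute.\<close>

lemma conj_eq_conj_iff_commute:
  assumes "c \<in> carrier G" "k \<in> carrier G" "k' \<in> carrier G" "k \<otimes> k' = k' \<otimes> k"
  shows "inv k \<otimes> c \<otimes> k = inv k' \<otimes> c \<otimes> k' \<longleftrightarrow> c \<otimes> (inv k \<otimes> k') = (inv k \<otimes> k') \<otimes> c"
proof -
  have "inv k \<otimes> c \<otimes> k = inv k' \<otimes> c \<otimes> k' \<longleftrightarrow> k' \<otimes> (inv k \<otimes> c \<otimes> k) = k' \<otimes> (inv k' \<otimes> c \<otimes> k')"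
    using assms by simp
  also have "\<dots> \<longleftrightarrow> k' \<otimes> (inv k \<otimes> c \<otimes> k) \<otimes> inv k = k' \<otimes> (inv k' \<otimes> c \<otimes> k') \<otimes> inv k"
    using assms by simp
  also have "k' \<otimes> (inv k \<otimes> c \<otimes> k) \<otimes> inv k = (k' \<otimes> inv k) \<otimes> c"
    using assms by (simp add: m_assoc)
  also have "k' \<otimes> (inv k' \<otimes> c \<otimes> k') \<otimes> inv k = c \<otimes> (k' \<otimes> inv k)"
    using assms by (simp add: m_assoc)
  also have "k' \<otimes> inv k = inv k \<otimes> k'"
    using assms commute_inv[of k' k] by simp
  finally show ?thesis by auto
qed

text \<open>Multiply the commutation equation by the inverse of \<open>a \<otimes> a'\<close> on the
  left and by the inverse of \<open>b \<otimes> b'\<close> on the right. Both inverses may be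
  written in either order, and with the suitable order each side collapses.\<close>

lemma products_commute_iff:
  assumes "a \<in> carrier G" "a' \<in> carrier G" "b \<in> carrier G" "b' \<in> carrier G"
    and ca: "a \<otimes> a' = a' \<otimes> a" and cb: "b \<otimes> b' = b' \<otimes> b"
  shows "(a \<otimes> b) \<otimes> (a' \<otimes> b') = (a' \<otimes> b') \<otimes> (a \<otimes> b) \<longleftrightarrow>
    inv a \<otimes> b' \<otimes> a \<otimes> inv b' = inv a' \<otimes> b \<otimes> a' \<otimes> inv b"
proof -
  have 1: "inv a \<otimes> inv a' = inv a' \<otimes> inv a"
    using assms by (metis inv_mult_group)
  have 2: "inv b \<otimes> inv b' = inv b' \<otimes> inv b"
    using assms by (metis inv_mult_group)
  have "(a \<otimes> b) \<otimes> (a' \<otimes> b') = (a' \<otimes> b') \<otimes> (a \<otimes> b) \<longleftrightarrow>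
      (inv a' \<otimes> inv a) \<otimes> ((a \<otimes> b) \<otimes> (a' \<otimes> b')) \<otimes> (inv b' \<otimes> inv b)
      = (inv a' \<otimes> inv a) \<otimes> ((a' \<otimes> b') \<otimes> (a \<otimes> b)) \<otimes> (inv b' \<otimes> inv b)"
    using assms by simp
  also have "(inv a' \<otimes> inv a) \<otimes> ((a \<otimes> b) \<otimes> (a' \<otimes> b')) \<otimes> (inv b' \<otimes> inv b)
      = inv a' \<otimes> b \<otimes> a' \<otimes> inv b"
    using assms by (simp add: m_assoc)
  also have "(inv a' \<otimes> inv a) \<otimes> ((a' \<otimes> b') \<otimes> (a \<otimes> b)) \<otimes> (inv b' \<otimes> inv b)
      = inv a \<otimes> b' \<otimes> a \<otimes> inv b'"
    unfolding 1[symmetric] 2[symmetric] using assms(1-4) by (simp add: m_assoc)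
  finally show ?thesis by auto
qed

lemma list_prod_closed [simp]: "set ws \<subseteq> carrier G \<Longrightarrow> list_prod G ws \<in> carrier G"
  by (induction ws) auto

lemma list_prod_append:
  "set us \<subseteq> carrier G \<Longrightarrow> set vs \<subseteq> carrier G \<Longrightarrow>
    list_prod G (us @ vs) = list_prod G us \<otimes> list_prod G vs"
  by (induction us) (auto simp: m_assoc)

lemma inv_list_prod:
  "set ws \<subseteq> carrier G \<Longrightarrow>
    inv (list_prod G ws) = list_prod G (rev (map (\<lambda>x. inv x) ws))"
proof (induction ws)
  case (Cons a ws)
  then have "set (rev (map (\<lambda>x. inv x) ws)) \<subseteq> carrier G" by auto
  then show ?case using Cons by (simp add: inv_mult_group list_prod_append)
qed simp

lemma word_ball_closed: "A \<subseteq> carrier G \<Longrightarrow> word_ball G A n \<subseteq> carrier G"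
  by (auto simp: word_ball_def)

lemma word_ball_mult:
  assumes "A \<subseteq> carrier G" "x \<in> word_ball G A m" "y \<in> word_ball G A n" "m + n \<le> p"
  shows "x \<otimes> y \<in> word_ball G A p"
proof -
  obtain us where us: "x = list_prod G us" "set us \<subseteq> A" "length us \<le> m"
    using assms(2) by (rule word_ballE)
  obtain vs where vs: "y = list_prod G vs" "set vs \<subseteq> A" "length vs \<le> n"
    using assms(3) by (rule word_ballE)
  have "x \<otimes> y = list_prod G (us @ vs)"
    using us vs assms(1) by (subst list_prod_append) auto
  then show ?thesis
    using us vs assms(4) word_ballI[of "us @ vs" A p G] by simp
qed

lemma word_ball_inv:
  assumes "A \<subseteq> carrier G" "(\<lambda>x. inv x) ` A \<subseteq> A" "x \<in> word_ball G A n"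
  shows "inv x \<in> word_ball G A n"
proof -
  obtain us where us: "x = list_prod G us" "set us \<subseteq> A" "length us \<le> n"
    using assms(3) by (rule word_ballE)
  have "inv x = list_prod G (rev (map (\<lambda>x. inv x) us))"
    using us assms(1) by (simp add: inv_list_prod subset_trans)
  then show ?thesis
    using us assms(2) word_ballI[of "rev (map (\<lambda>x. inv x) us)" A n G] by fastforce
qed

end

section \<open>Two homomorphisms and the elements at which their values commute\<close>

locale hom_pair = G: group G + P: group P
  for G :: "('a, 'm) monoid_scheme" and P :: "('b, 'n) monoid_scheme" +
  fixes i j :: "'a \<Rightarrow> 'b"
  assumes i_hom: "i \<in> hom G P" and j_hom: "j \<in> hom G P"
begin

sublocale i: group_hom G P i
  by unfold_locales (rule i_hom)

sublocale j: group_hom G P j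
  by unfold_locales (rule j_hom)

text \<open>In the application \<open>P\<close> is given by finitely many generators and relators,
  and \<open>i\<close>, \<open>j\<close> are the maps of \<open>G\<close> and of its copy into
  \<open>P\<close>. The aim is to show that this set is all of \<open>carrier G\<close>; it need not
  be closed under products, so membership of a product needs its own criterion.\<close>

definition commuting :: "'a set" where
  "commuting = {g \<in> carrier G. i g \<otimes>\<^bsub>P\<^esub> j g = j g \<otimes>\<^bsub>P\<^esub> i g}"

text \<open>The element l(g) of the introductory text, mapped into \<open>P\<close>.\<close>

definition diff :: "'a \<Rightarrow> 'b" where
  "diff g = inv\<^bsub>P\<^esub> i g \<otimes>\<^bsub>P\<^esub> j g"

text \<open>The commutator of the inverse of \<open>i g\<close> with \<open>j h\<close>, called c(g,
  h) in the introductory text; \<open>comm_ji\<close> exchanges the roles of \<open>i\<close> and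
  \<open>j\<close>.\<close>

definition comm_ij :: "'a \<Rightarrow> 'a \<Rightarrow> 'b" where
  "comm_ij g h = inv\<^bsub>P\<^esub> i g \<otimes>\<^bsub>P\<^esub> j h \<otimes>\<^bsub>P\<^esub> i g \<otimes>\<^bsub>P\<^esub> inv\<^bsub>P\<^esub> j h"

definition comm_ji :: "'a \<Rightarrow> 'a \<Rightarrow> 'b" where
  "comm_ji g h = inv\<^bsub>P\<^esub> j g \<otimes>\<^bsub>P\<^esub> i h \<otimes>\<^bsub>P\<^esub> j g \<otimes>\<^bsub>P\<^esub> inv\<^bsub>P\<^esub> i h"

lemma commuting_closed: "g \<in> commuting \<Longrightarrow> g \<in> carrier G"
  by (simp add: commuting_def)

lemma diff_closed [simp]: "g \<in> carrier G \<Longrightarrow> diff g \<in> carrier P"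
  by (simp add: diff_def)

lemma comm_closed [simp]:
  "g \<in> carrier G \<Longrightarrow> h \<in> carrier G \<Longrightarrow> comm_ij g h \<in> carrier P"
  "g \<in> carrier G \<Longrightarrow> h \<in> carrier G \<Longrightarrow> comm_ji g h \<in> carrier P"
  by (simp_all add: comm_ij_def comm_ji_def)

lemma mult_commuting_iff:
  assumes "g \<in> commuting" "h \<in> commuting"
  shows "g \<otimes>\<^bsub>G\<^esub> h \<in> commuting \<longleftrightarrow> comm_ij g h = comm_ji g h"
  using assms P.products_commute_iff[of "i g" "j g" "i h" "j h"]
  by (simp add: commuting_def comm_ij_def comm_ji_def)

text \<open>The usual expansion of a commutator with a product in its first entry. It isolates how
  the middle factor of \<open>g \<otimes> k \<otimes> h\<close> acts: by conjugation on the part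
  belonging to \<open>g\<close> and \<open>h\<close>.\<close>

lemma comm_mult:
  assumes "g \<in> carrier G" "k \<in> carrier G" "h \<in> carrier G"
  shows "comm_ij (g \<otimes>\<^bsub>G\<^esub> k) h = inv\<^bsub>P\<^esub> i k \<otimes>\<^bsub>P\<^esub> comm_ij g h \<otimes>\<^bsub>P\<^esub> i k \<otimes>\<^bsub>P\<^esub> comm_ij k h"
    and "comm_ji (g \<otimes>\<^bsub>G\<^esub> k) h = inv\<^bsub>P\<^esub> j k \<otimes>\<^bsub>P\<^esub> comm_ji g h \<otimes>\<^bsub>P\<^esub> j k \<otimes>\<^bsub>P\<^esub> comm_ji k h"
  using assms by (simp_all add: comm_ij_def comm_ji_def P.m_assoc P.inv_mult_group)

text \<open>Apply \<open>mult_commuting_iff\<close> to \<open>g \<otimes> k\<close> and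
  \<open>h\<close> and expand with \<open>comm_mult\<close>. The factors for \<open>k\<close> and
  \<open>h\<close> agree and cancel, and what remains says that \<open>i k\<close> and
  \<open>j k\<close> conjugate \<open>comm_ij g h\<close> in the same way.\<close>

lemma triple_commuting_iff:
  assumes "g \<in> commuting" "h \<in> commuting" "k \<in> commuting"
    and "g \<otimes>\<^bsub>G\<^esub> h \<in> commuting" "g \<otimes>\<^bsub>G\<^esub> k \<in> commuting" "k \<otimes>\<^bsub>G\<^esub> h \<in> commuting"
  shows "g \<otimes>\<^bsub>G\<^esub> k \<otimes>\<^bsub>G\<^esub> h \<in> commuting \<longleftrightarrow>
    comm_ij g h \<otimes>\<^bsub>P\<^esub> diff k = diff k \<otimes>\<^bsub>P\<^esub> comm_ij g h"
proof -
  have car: "g \<in> carrier G" "h \<in> carrier G" "k \<in> carrier G"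
    using assms commuting_closed by auto
  have "comm_ij g h = comm_ji g h" "comm_ij k h = comm_ji k h"
    using assms mult_commuting_iff by auto
  then have "g \<otimes>\<^bsub>G\<^esub> k \<otimes>\<^bsub>G\<^esub> h \<in> commuting \<longleftrightarrow>
      inv\<^bsub>P\<^esub> i k \<otimes>\<^bsub>P\<^esub> comm_ij g h \<otimes>\<^bsub>P\<^esub> i k = inv\<^bsub>P\<^esub> j k \<otimes>\<^bsub>P\<^esub> comm_ij g h \<otimes>\<^bsub>P\<^esub> j k"
    using assms car by (simp add: mult_commuting_iff comm_mult)
  also have "\<dots> \<longleftrightarrow> comm_ij g h \<otimes>\<^bsub>P\<^esub> diff k = diff k \<otimes>\<^bsub>P\<^esub> comm_ij g h"
    unfolding diff_def using assms car
    by (intro P.conj_eq_conj_iff_commute) (auto simp: commuting_def)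
  finally show ?thesis .
qed

text \<open>For \<open>w = b \<otimes> inv a\<close> the element \<open>diff (w \<otimes> b)\<close>
  is \<open>diff w\<close> placed between the inverse of \<open>i b\<close> and \<open>j b\<close>.
  As \<open>i w\<close> and \<open>j w\<close> commute, \<open>diff w\<close> may be read with
  \<open>j w\<close> in front, and expanding \<open>w\<close> then produces the three
  factors.\<close>

lemma diff_core:
  assumes "a \<in> carrier G" "b \<in> carrier G" "b \<otimes>\<^bsub>G\<^esub> inv\<^bsub>G\<^esub> a \<in> commuting"
  shows "diff (b \<otimes>\<^bsub>G\<^esub> inv\<^bsub>G\<^esub> a \<otimes>\<^bsub>G\<^esub> b) = diff b \<otimes>\<^bsub>P\<^esub> inv\<^bsub>P\<^esub> diff a \<otimes>\<^bsub>P\<^esub> diff b"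
proof -
  define w where "w = b \<otimes>\<^bsub>G\<^esub> inv\<^bsub>G\<^esub> a"
  have w: "w \<in> carrier G" "i w \<otimes>\<^bsub>P\<^esub> j w = j w \<otimes>\<^bsub>P\<^esub> i w"
    using assms by (auto simp: commuting_def w_def)
  have "diff (w \<otimes>\<^bsub>G\<^esub> b) = inv\<^bsub>P\<^esub> i b \<otimes>\<^bsub>P\<^esub> (inv\<^bsub>P\<^esub> i w \<otimes>\<^bsub>P\<^esub> j w) \<otimes>\<^bsub>P\<^esub> j b"
    using w assms by (simp add: diff_def P.m_assoc P.inv_mult_group)
  also have "inv\<^bsub>P\<^esub> i w \<otimes>\<^bsub>P\<^esub> j w = j w \<otimes>\<^bsub>P\<^esub> inv\<^bsub>P\<^esub> i w"
    using w P.commute_inv[of "j w" "i w"] by simp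
  also have "inv\<^bsub>P\<^esub> i b \<otimes>\<^bsub>P\<^esub> (j w \<otimes>\<^bsub>P\<^esub> inv\<^bsub>P\<^esub> i w) \<otimes>\<^bsub>P\<^esub> j b
      = diff b \<otimes>\<^bsub>P\<^esub> inv\<^bsub>P\<^esub> diff a \<otimes>\<^bsub>P\<^esub> diff b"
    using assms by (simp add: w_def diff_def P.m_assoc P.inv_mult_group)
  finally show ?thesis by (simp add: w_def)
qed

text \<open>A word longer than the alphabet repeats a letter, \<open>k = u x d x c\<close>; then \<open>k = b a\<^sup>-\<^sup>1 b\<close> with
  the shorter words \<open>b = u x c\<close> and \<open>a = u d\<^sup>-\<^sup>1 c\<close>.\<close>

lemma long_word_core:
  assumes A: "A \<subseteq> carrier G" "(\<lambda>x. inv\<^bsub>G\<^esub> x) ` A \<subseteq> A" "finite A"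
    and ks: "set ks \<subseteq> A" "length ks = Suc (card A)"
  obtains a b where "a \<in> word_ball G A (card A)" "b \<in> word_ball G A (card A)"
    "b \<otimes>\<^bsub>G\<^esub> inv\<^bsub>G\<^esub> a \<in> word_ball G A (2 * card A)"
    "list_prod G ks = b \<otimes>\<^bsub>G\<^esub> inv\<^bsub>G\<^esub> a \<otimes>\<^bsub>G\<^esub> b"
proof -
  have "\<not> distinct ks"
  proof
    assume "distinct ks"
    then have "length ks = card (set ks)" by (simp add: distinct_card)
    also have "\<dots> \<le> card A" using ks A by (intro card_mono)
    finally show False using ks by simp
  qed
  then obtain us x ds cs where k: "ks = us @ [x] @ ds @ [x] @ cs"
    using not_distinct_decomp by blast
  have sub: "set us \<subseteq> A" "x \<in> A" "set ds \<subseteq> A" "set cs \<subseteq> A"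
    using ks k by auto
  then have subc: "set us \<subseteq> carrier G" "x \<in> carrier G" "set ds \<subseteq> carrier G" "set cs \<subseteq> carrier G"
    using A by auto
  let ?u = "list_prod G us" and ?d = "list_prod G ds" and ?c = "list_prod G cs"
  have car: "?u \<in> carrier G" "?d \<in> carrier G" "?c \<in> carrier G" "x \<in> carrier G"
    using subc by auto
  have len: "length us + length ds + length cs + 2 = Suc (card A)"
    using ks k by simp
  have balls: "?u \<in> word_ball G A (length us)" "?d \<in> word_ball G A (length ds)"
    "?c \<in> word_ball G A (length cs)" "x \<in> word_ball G A 1"
    using sub word_ballI[of "[x]" A 1 G] car by (auto intro: word_ballI)
  note inv_balls = balls(1,2)[THEN G.word_ball_inv[OF A(1,2)]]
  have b: "?u \<otimes>\<^bsub>G\<^esub> x \<otimes>\<^bsub>G\<^esub> ?c \<in> word_ball G A (card A)"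
    using len by (intro G.word_ball_mult[OF A(1) G.word_ball_mult[OF A(1) balls(1) _ order.refl] balls(3)])
      (use balls in auto)
  have a: "?u \<otimes>\<^bsub>G\<^esub> inv\<^bsub>G\<^esub> ?d \<otimes>\<^bsub>G\<^esub> ?c \<in> word_ball G A (card A)"
    using len by (intro G.word_ball_mult[OF A(1)
        G.word_ball_mult[OF A(1) balls(1) inv_balls(2) order.refl] balls(3)]) auto
  \<comment> \<open>The factor \<open>?c\<close> cancels in \<open>b \<otimes> inv a\<close>. The
    remaining word has at most \<open>2 * length us + length ds + 1\<close> letters, which stays
    below \<open>2 * card A\<close> although \<open>a\<close> and \<open>b\<close> may both have
    length close to \<open>card A\<close>.\<close>
  have eq: "?u \<otimes>\<^bsub>G\<^esub> x \<otimes>\<^bsub>G\<^esub> ?c \<otimes>\<^bsub>G\<^esub> inv\<^bsub>G\<^esub> (?u \<otimes>\<^bsub>G\<^esub> inv\<^bsub>G\<^esub> ?d \<otimes>\<^bsub>G\<^esub> ?c)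
      = (?u \<otimes>\<^bsub>G\<^esub> x \<otimes>\<^bsub>G\<^esub> ?d) \<otimes>\<^bsub>G\<^esub> inv\<^bsub>G\<^esub> ?u"
    using car by (simp add: G.m_assoc G.inv_mult_group)
  have "list_prod G ks = ?u \<otimes>\<^bsub>G\<^esub> x \<otimes>\<^bsub>G\<^esub> ?c \<otimes>\<^bsub>G\<^esub> inv\<^bsub>G\<^esub> (?u \<otimes>\<^bsub>G\<^esub> inv\<^bsub>G\<^esub> ?d \<otimes>\<^bsub>G\<^esub> ?c)
      \<otimes>\<^bsub>G\<^esub> (?u \<otimes>\<^bsub>G\<^esub> x \<otimes>\<^bsub>G\<^esub> ?c)"
    using subc car by (simp add: k G.list_prod_append G.m_assoc G.inv_mult_group)
  moreover have "(?u \<otimes>\<^bsub>G\<^esub> x \<otimes>\<^bsub>G\<^esub> ?d) \<otimes>\<^bsub>G\<^esub> inv\<^bsub>G\<^esub> ?u \<in> word_ball G A (2 * card A)"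
    using len by (intro G.word_ball_mult[OF A(1) G.word_ball_mult[OF A(1)
        G.word_ball_mult[OF A(1) balls(1) _ order.refl] balls(2) order.refl] inv_balls(1)])
      (use balls in auto)
  ultimately show ?thesis using that[OF a b] eq by simp
qed

text \<open>Induction on the radius. A word with more than \<open>2 * card A + 2\<close> letters is
  cut into a letter \<open>g\<close>, a block \<open>k\<close> of \<open>card A + 1\<close> letters
  and a rest \<open>h\<close>. The block is long enough to repeat a letter, while the radius leaves
  room for \<open>b \<otimes> inv a\<close> with its \<open>2 * card A\<close> letters and for
  \<open>g \<otimes> k\<close> with \<open>card A + 2\<close>.\<close>

lemma commuting_all:
  assumes A: "A \<subseteq> carrier G" "(\<lambda>x. inv\<^bsub>G\<^esub> x) ` A \<subseteq> A" "finite A"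
    and ball: "word_ball G A (2 * card A + 2) \<subseteq> commuting"
    and gen: "\<And>g. g \<in> carrier G \<Longrightarrow> \<exists>n. g \<in> word_ball G A n"
  shows "commuting = carrier G"
proof -
  have "word_ball G A n \<subseteq> commuting" for n
  proof (induction n)
    case 0
    then show ?case using ball word_ball_mono[of 0 "2 * card A + 2" G A] by blast
  next
    case (Suc n)
    show ?case
    proof (cases "Suc n \<le> 2 * card A + 2")
      case True
      then show ?thesis using ball word_ball_mono[of "Suc n" "2 * card A + 2" G A] by blast
    next
      case False
      show ?thesis
      proof
        fix w assume "w \<in> word_ball G A (Suc n)"
        then obtain ws where ws: "w = list_prod G ws" "set ws \<subseteq> A" "length ws \<le> Suc n"
          by (rule word_ballE)
        show "w \<in> commuting"
        proof (cases "length ws = Suc n")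
          case False
          then have "w \<in> word_ball G A n" using ws by (auto intro: word_ballI)
          then show ?thesis using Suc by blast
        next
          case True
          then obtain g vs where vs: "ws = g # vs" by (cases ws) auto
          \<comment> \<open>The block has one letter more than \<open>card A\<close>, as
            \<open>long_word_core\<close> requires.\<close>
          define ks where "ks = take (Suc (card A)) vs"
          define hs where "hs = drop (Suc (card A)) vs"
          have sub: "g \<in> A" "set vs \<subseteq> A" using ws vs by auto
          have len: "length ks = Suc (card A)" "length hs = n - Suc (card A)"
            using True vs \<open>\<not> Suc n \<le> 2 * card A + 2\<close> by (auto simp: ks_def hs_def)
          have subk: "set ks \<subseteq> A" "set hs \<subseteq> A"
            using sub set_take_subset[of "Suc (card A)" vs] set_drop_subset[of "Suc (card A)" vs]
            unfolding ks_def hs_def by blast+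
          let ?k = "list_prod G ks" and ?h = "list_prod G hs"
          have g: "g \<in> carrier G" "g \<in> word_ball G A 1"
            using sub A word_ballI[of "[g]" A 1 G] by auto
          have h: "?h \<in> carrier G" "?h \<in> word_ball G A (n - Suc (card A))"
            using subk A len by (auto intro!: word_ballI G.list_prod_closed)
          have k: "?k \<in> carrier G" "?k \<in> word_ball G A (Suc (card A))"
            using subk A len by (auto intro!: word_ballI G.list_prod_closed)
          have short: "x \<in> commuting" if "x \<in> word_ball G A m" "m \<le> n" for x m
            using that Suc word_ball_mono[of m n G A] by blast
          have n: "2 * card A + 2 \<le> n" using False by simp
          have S: "g \<in> commuting" "?h \<in> commuting" "g \<otimes>\<^bsub>G\<^esub> ?h \<in> commuting"
            using n G.word_ball_mult[OF A(1) g(2) h(2) order.refl] g h by (auto intro: short)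
          \<comment> \<open>Stated for every \<open>x\<close> of the length of the block, since
            these side conditions of \<open>triple_commuting_iff\<close> are needed for
            \<open>?k\<close> itself as well as for the shorter \<open>a\<close> and
            \<open>b\<close>.\<close>
          have Sk: "x \<in> commuting" "g \<otimes>\<^bsub>G\<^esub> x \<in> commuting" "x \<otimes>\<^bsub>G\<^esub> ?h \<in> commuting"
            if "x \<in> word_ball G A (Suc (card A))" for x
            using n that G.word_ball_mult[OF A(1) g(2) that order.refl]
              G.word_ball_mult[OF A(1) that h(2) order.refl] by (auto intro: short)
          \<comment> \<open>Replacing the block by a word of at most \<open>card A\<close> letters
            leaves at most \<open>n\<close> letters in total, so the induction hypothesis covers the
            whole product and \<open>triple_commuting_iff\<close> is read from left to
            right.\<close>
          have cent: "comm_ij g ?h \<otimes>\<^bsub>P\<^esub> diff x = diff x \<otimes>\<^bsub>P\<^esub> comm_ij g ?h"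
            if x: "x \<in> word_ball G A (card A)" for x
          proof -
            have x': "x \<in> word_ball G A (Suc (card A))"
              using x word_ball_mono[of "card A" "Suc (card A)" G A] by auto
            have "g \<otimes>\<^bsub>G\<^esub> x \<otimes>\<^bsub>G\<^esub> ?h \<in> commuting"
              using n G.word_ball_mult[OF A(1) G.word_ball_mult[OF A(1) g(2) x order.refl] h(2) order.refl]
              by (auto intro: short)
            then show ?thesis
              using triple_commuting_iff[OF S(1,2) Sk(1)[OF x'] S(3) Sk(2,3)[OF x']] by simp
          qed
          obtain a b where ab: "a \<in> word_ball G A (card A)" "b \<in> word_ball G A (card A)"
            "b \<otimes>\<^bsub>G\<^esub> inv\<^bsub>G\<^esub> a \<in> word_ball G A (2 * card A)"
            "?k = b \<otimes>\<^bsub>G\<^esub> inv\<^bsub>G\<^esub> a \<otimes>\<^bsub>G\<^esub> b"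
            using long_word_core[OF A subk(1) len(1)] .
          have car: "a \<in> carrier G" "b \<in> carrier G"
            using ab G.word_ball_closed[OF A(1)] by auto
          have "b \<otimes>\<^bsub>G\<^esub> inv\<^bsub>G\<^esub> a \<in> commuting"
            using ab(3) n by (auto intro: short)
          then have "diff ?k = diff b \<otimes>\<^bsub>P\<^esub> inv\<^bsub>P\<^esub> diff a \<otimes>\<^bsub>P\<^esub> diff b"
            unfolding ab(4) by (rule diff_core[OF car])
          then have "comm_ij g ?h \<otimes>\<^bsub>P\<^esub> diff ?k = diff ?k \<otimes>\<^bsub>P\<^esub> comm_ij g ?h"
            using car g h cent[OF ab(1)] cent[OF ab(2)]
            by (auto intro!: P.commute_mult P.commute_inv)
          \<comment> \<open>Now \<open>triple_commuting_iff\<close> is read from right to left, at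
            the block itself.\<close>
          then have "g \<otimes>\<^bsub>G\<^esub> ?k \<otimes>\<^bsub>G\<^esub> ?h \<in> commuting"
            using triple_commuting_iff[OF S(1,2) Sk(1)[OF k(2)] S(3) Sk(2,3)[OF k(2)]] by simp
          moreover have "w = g \<otimes>\<^bsub>G\<^esub> ?k \<otimes>\<^bsub>G\<^esub> ?h"
          proof -
            have "vs = ks @ hs" by (simp add: ks_def hs_def)
            then have "list_prod G vs = ?k \<otimes>\<^bsub>G\<^esub> ?h"
              using subk A by (simp add: G.list_prod_append subset_trans)
            then show ?thesis using ws vs g k h by (simp add: G.m_assoc)
          qed
          ultimately show ?thesis by simp
        qed
      qed
    qed
  qed
  then show ?thesis using gen commuting_closed by blast
qed

end

section \<open>Presentations\<close>

text \<open>The epimorphism \<open>\<phi>\<close> is kept explicit, whereas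
  \<open>finitely_presented\<close> hides it behind an isomorphism: the images of generators and
  relators are needed by name.\<close>

definition presents ::
  "('f, 'm) monoid_scheme \<Rightarrow> 'f set \<Rightarrow> ('f \<Rightarrow> 'a) \<Rightarrow> ('a, 'n) monoid_scheme \<Rightarrow> bool" where
  "presents F R \<phi> G \<longleftrightarrow> \<phi> \<in> hom F G \<and> \<phi> ` carrier F = carrier G \<and> R \<subseteq> carrier F \<and>
    kernel F G \<phi> = normal_closure F R"

lemma presentsD:
  assumes "presents F R \<phi> G"
  shows "\<phi> \<in> hom F G" "\<phi> ` carrier F = carrier G" "R \<subseteq> carrier F"
    "kernel F G \<phi> = normal_closure F R"
  using assms by (auto simp: presents_def)

lemma subset_normal_closure: "S \<subseteq> normal_closure G S"
  by (auto simp: normal_closure_def)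

lemma normal_closure_minimal: "N \<lhd> G \<Longrightarrow> S \<subseteq> N \<Longrightarrow> normal_closure G S \<subseteq> N"
  by (auto simp: normal_closure_def)

lemma normal_closure_subset_kernel:
  assumes "group F" "group G" "\<phi> \<in> hom F G" "R \<subseteq> carrier F" "\<And>r. r \<in> R \<Longrightarrow> \<phi> r = \<one>\<^bsub>G\<^esub>"
  shows "normal_closure F R \<subseteq> kernel F G \<phi>"
proof -
  interpret group_hom F G \<phi>
    using assms by (simp add: group_hom_def group_hom_axioms_def)
  show ?thesis
    using assms by (intro normal_closure_minimal normal_kernel) (auto simp: kernel_def)
qed

lemma presents_relator:
  assumes "presents F R \<phi> G" "r \<in> R"
  shows "\<phi> r = \<one>\<^bsub>G\<^esub>"
  using presentsD[OF assms(1)] subset_normal_closure[of R F] assms(2)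
  by (auto simp: kernel_def)

lemma group_quotient_normal_closure:
  "group F \<Longrightarrow> R \<subseteq> carrier F \<Longrightarrow> group (F Mod normal_closure F R)"
  by (intro normal.factorgroup_is_group normal_closure_normal)

lemma presents_quotient:
  assumes "group F" "R \<subseteq> carrier F"
  shows "presents F R (r_coset F (normal_closure F R)) (F Mod normal_closure F R)"
proof -
  interpret normal "normal_closure F R" F
    using assms by (rule normal_closure_normal)
  have "kernel F (F Mod normal_closure F R) (r_coset F (normal_closure F R)) = normal_closure F R"
    using subset coset_join1[OF _ _ subgroup_axioms] coset_join2[OF _ subgroup_axioms]
    by (auto simp: kernel_def)
  then show ?thesis
    using assms r_coset_hom_Mod by (simp add: presents_def carrier_FactGroup)
qed

text \<open>Von Dyck's theorem: a homomorphism that kills \<open>R\<close> kills its normal closure,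
  which is the kernel of \<open>\<phi>\<close>, and so is constant on the fibres of
  \<open>\<phi>\<close>.\<close>

lemma presents_lift:
  assumes groups: "group F" "group G" "group H"
    and pres: "presents F R \<phi> G" and th: "\<theta> \<in> hom F H" "\<And>r. r \<in> R \<Longrightarrow> \<theta> r = \<one>\<^bsub>H\<^esub>"
  obtains \<psi> where "\<psi> \<in> hom G H" "\<And>a. a \<in> carrier F \<Longrightarrow> \<psi> (\<phi> a) = \<theta> a"
proof -
  interpret \<phi>: group_hom F G \<phi>
    using groups presentsD[OF pres] by (simp add: group_hom_def group_hom_axioms_def)
  interpret \<theta>: group_hom F H \<theta>
    using groups th by (simp add: group_hom_def group_hom_axioms_def)
  have ker: "kernel F G \<phi> \<subseteq> kernel F H \<theta>"
    using groups th presentsD[OF pres] by (simp add: normal_closure_subset_kernel)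
  have eq: "\<theta> a = \<theta> b" if "a \<in> carrier F" "b \<in> carrier F" "\<phi> a = \<phi> b" for a b
  proof -
    have "a \<otimes>\<^bsub>F\<^esub> inv\<^bsub>F\<^esub> b \<in> kernel F G \<phi>"
      using that by (simp add: kernel_def)
    then have "\<theta> (a \<otimes>\<^bsub>F\<^esub> inv\<^bsub>F\<^esub> b) = \<one>\<^bsub>H\<^esub>" using ker by (auto simp: kernel_def)
    then have "\<theta> a \<otimes>\<^bsub>H\<^esub> inv\<^bsub>H\<^esub> \<theta> b = \<theta> b \<otimes>\<^bsub>H\<^esub> inv\<^bsub>H\<^esub> \<theta> b"
      using that by simp
    then show ?thesis
      using that \<theta>.H.right_cancel[of "inv\<^bsub>H\<^esub> \<theta> b" "\<theta> a" "\<theta> b"] by simp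
  qed
  \<comment> \<open>The choice of preimage is immaterial by \<open>eq\<close>.\<close>
  define \<psi> where "\<psi> g = \<theta> (SOME a. a \<in> carrier F \<and> \<phi> a = g)" for g
  have \<psi>: "\<psi> (\<phi> a) = \<theta> a" if "a \<in> carrier F" for a
  proof -
    have "(SOME b. b \<in> carrier F \<and> \<phi> b = \<phi> a) \<in> carrier F \<and>
        \<phi> (SOME b. b \<in> carrier F \<and> \<phi> b = \<phi> a) = \<phi> a"
      by (rule someI[of _ a]) (use that in simp)
    then show ?thesis unfolding \<psi>_def using that by (blast intro: eq)
  qed
  have "\<psi> \<in> hom G H"
  proof (rule homI)
    have sur: "\<exists>a\<in>carrier F. g = \<phi> a" if "g \<in> carrier G" for g
      using that unfolding presentsD(2)[OF pres, symmetric] by blast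
    show "\<psi> g \<in> carrier H" if "g \<in> carrier G" for g
    proof -
      from sur[OF that] obtain a where "a \<in> carrier F" "g = \<phi> a" by blast
      then show ?thesis using \<psi>[of a] by simp
    qed
    show "\<psi> (g \<otimes>\<^bsub>G\<^esub> h) = \<psi> g \<otimes>\<^bsub>H\<^esub> \<psi> h" if "g \<in> carrier G" "h \<in> carrier G" for g h
    proof -
      from sur[OF that(1)] sur[OF that(2)]
      obtain a b where ab: "a \<in> carrier F" "b \<in> carrier F" "g = \<phi> a" "h = \<phi> b" by blast
      then have "\<psi> (g \<otimes>\<^bsub>G\<^esub> h) = \<psi> (\<phi> (a \<otimes>\<^bsub>F\<^esub> b))" by simp
      also have "\<dots> = \<theta> (a \<otimes>\<^bsub>F\<^esub> b)" using ab by (intro \<psi>) simp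
      finally show ?thesis using ab \<psi>[of a] \<psi>[of b] by simp
    qed
  qed
  then show ?thesis using that \<psi> by blast
qed

text \<open>The map \<open>\<psi>\<close> recovers the coset of \<open>a\<close> from
  \<open>\<phi> a\<close>. If \<open>\<phi> a\<close> is trivial, so is that coset, hence no kernel
  element lies outside the normal closure of \<open>R\<close>.\<close>

lemma presentsI:
  assumes groups: "group F" "group G"
    and \<phi>: "\<phi> \<in> hom F G" "\<phi> ` carrier F = carrier G"
    and R: "R \<subseteq> carrier F" "\<And>r. r \<in> R \<Longrightarrow> \<phi> r = \<one>\<^bsub>G\<^esub>"
    and \<psi>: "\<psi> \<in> hom G (F Mod normal_closure F R)"
      "\<And>a. a \<in> carrier F \<Longrightarrow> \<psi> (\<phi> a) = r_coset F (normal_closure F R) a"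
  shows "presents F R \<phi> G"
proof -
  have "a \<in> normal_closure F R" if "a \<in> carrier F" "\<phi> a = \<one>\<^bsub>G\<^esub>" for a
  proof -
    have "r_coset F (normal_closure F R) a = \<one>\<^bsub>F Mod normal_closure F R\<^esub>"
      using \<psi>(2)[OF that(1)] that(2)
        hom_one[OF \<psi>(1) groups(2) group_quotient_normal_closure[OF groups(1) R(1)]] by simp
    then show ?thesis
      using that presentsD(4)[OF presents_quotient[OF groups(1) R(1)]] by (auto simp: kernel_def)
  qed
  then have "kernel F G \<phi> \<subseteq> normal_closure F R" by (auto simp: kernel_def)
  then show ?thesis
    using normal_closure_subset_kernel[OF groups \<phi>(1) R] \<phi> R by (auto simp: presents_def)
qed

text \<open>From left to right the quotient map is followed by an isomorphism, which does not change
  the kernel; the converse is the first isomorphism theorem.\<close>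

lemma finitely_presented_iff_presents:
  assumes "group G"
  shows "finitely_presented G \<longleftrightarrow>
    (\<exists>(X :: nat set) R \<phi>. finite X \<and> finite R \<and> presents (free_group X) R \<phi> G)"
proof
  assume "finitely_presented G"
  then obtain X :: "nat set" and R where X: "finite X" "finite R" "R \<subseteq> carrier (free_group X)"
    and iso: "G \<cong> free_group X Mod normal_closure (free_group X) R"
    by (auto simp: finitely_presented_def)
  let ?F = "free_group X" and ?N = "normal_closure (free_group X) R"
  have Q: "group (?F Mod ?N)"
    using free_group_is_group X(3) by (rule group_quotient_normal_closure)
  obtain \<sigma> where "\<sigma> \<in> iso (?F Mod ?N) G"
    using group.iso_sym[OF assms iso] by (auto simp: is_iso_def)
  then have \<sigma>: "\<sigma> \<in> hom (?F Mod ?N) G" "bij_betw \<sigma> (carrier (?F Mod ?N)) (carrier G)"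
    by (auto simp: iso_def)
  have pres: "presents ?F R (r_coset ?F ?N) (?F Mod ?N)"
    using free_group_is_group X(3) by (rule presents_quotient)
  note p = presentsD[OF pres]
  have "presents ?F R (\<sigma> \<circ> r_coset ?F ?N) G"
    unfolding presents_def
  proof (intro conjI)
    show "\<sigma> \<circ> r_coset ?F ?N \<in> hom ?F G" using p(1) \<sigma>(1) by (rule hom_compose)
    show "(\<sigma> \<circ> r_coset ?F ?N) ` carrier ?F = carrier G"
      using \<sigma>(2) by (simp only: image_comp [symmetric] p(2) bij_betw_def)
    have "\<sigma> U = \<one>\<^bsub>G\<^esub> \<longleftrightarrow> U = \<one>\<^bsub>?F Mod ?N\<^esub>" if "U \<in> carrier (?F Mod ?N)" for U
      using inj_on_eq_iff[OF bij_betw_imp_inj_on[OF \<sigma>(2)] that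
          monoid.one_closed[OF group.is_monoid[OF Q]]]
      unfolding hom_one[OF \<sigma>(1) Q assms] .
    then have "kernel ?F G (\<sigma> \<circ> r_coset ?F ?N) = kernel ?F (?F Mod ?N) (r_coset ?F ?N)"
      unfolding kernel_def using hom_in_carrier[OF p(1)] by (intro Collect_cong) auto
    then show "kernel ?F G (\<sigma> \<circ> r_coset ?F ?N) = ?N"
      using p(4) by simp
  qed (rule X)
  then show "\<exists>(X :: nat set) R \<phi>. finite X \<and> finite R \<and> presents (free_group X) R \<phi> G"
    using X by blast
next
  assume "\<exists>(X :: nat set) R \<phi>. finite X \<and> finite R \<and> presents (free_group X) R \<phi> G"
  then obtain X :: "nat set" and R \<phi> where X: "finite X" "finite R" "presents (free_group X) R \<phi> G"
    by blast
  note p = presentsD[OF X(3)]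
  interpret group_hom "free_group X" G \<phi>
    using assms p(1) free_group_is_group by (simp add: group_hom_def group_hom_axioms_def)
  have "free_group X Mod normal_closure (free_group X) R \<cong> G"
    using FactGroup_iso[OF p(2)] p(4) by simp
  then have "G \<cong> free_group X Mod normal_closure (free_group X) R"
    using group.iso_sym[OF group_quotient_normal_closure[OF G.is_group p(3)]] by blast
  then show "finitely_presented G"
    using X p(3) by (auto simp: finitely_presented_def)
qed


section \<open>Universal properties\<close>

abbreviation word_class :: "'x set \<Rightarrow> ('x list \<times> 'x list) set \<Rightarrow> 'x list \<Rightarrow> 'x list set" where
  "word_class A R w \<equiv> word_cong A R `` {w}"

lemma word_class_eq: "(u, v) \<in> word_cong A R \<Longrightarrow> word_class A R u = word_class A R v"
  by (rule equiv_class_eq[OF equiv_word_cong])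

lemma word_class_in_carrier: "w \<in> lists A \<Longrightarrow> word_class A R w \<in> carrier (word_quotient A R)"
  by (auto simp: word_quotient_def intro!: quotientI)

lemma word_quotient_carrierE:
  assumes "U \<in> carrier (word_quotient A R)"
  obtains w where "w \<in> lists A" "U = word_class A R w"
  using assms by (auto simp: word_quotient_def elim!: quotientE)

lemma word_quotient_one: "\<one>\<^bsub>word_quotient A R\<^esub> = word_class A R []"
  by (simp add: word_quotient_def)

lemma word_class_Cons:
  "a \<in> A \<Longrightarrow> w \<in> lists A \<Longrightarrow>
    word_class A R (a # w) = word_class A R [a] \<otimes>\<^bsub>word_quotient A R\<^esub> word_class A R w"
  using word_quotient_mult[of "[a]" A w R] by simp

text \<open>Evaluating words letter by letter in \<open>H\<close> respects the generating pairs and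
  products, hence the whole congruence. The universal properties of free groups and of free products
  are both instances.\<close>

lemma word_quotient_lift:
  assumes H: "group H" and f: "\<And>a. a \<in> A \<Longrightarrow> f a \<in> carrier H"
    and R: "\<And>l r. (l, r) \<in> R \<Longrightarrow> l \<in> lists A \<Longrightarrow> r \<in> lists A \<Longrightarrow>
      list_prod H (map f l) = list_prod H (map f r)"
  obtains h where "h \<in> hom (word_quotient A R) H"
    "\<And>a. a \<in> A \<Longrightarrow> h (word_class A R [a]) = f a"
proof -
  interpret H: group H by fact
  let ?e = "\<lambda>w. list_prod H (map f w)"
  have closed: "set (map f w) \<subseteq> carrier H" if "w \<in> lists A" for w
    using that f by auto
  have app: "?e (u @ v) = ?e u \<otimes>\<^bsub>H\<^esub> ?e v" if "u \<in> lists A" "v \<in> lists A" for u v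
    using H.list_prod_append[OF closed closed, of u v] that by simp
  have cong: "?e u = ?e v" if "(u, v) \<in> word_cong A R" for u v
    using that
  proof (induction rule: word_cong.induct)
    case (step l r u v)
    then have "l @ v \<in> lists A" "r @ v \<in> lists A" by auto
    then show ?case
      using app[OF step(4), of "l @ v"] app[OF step(4), of "r @ v"]
        app[OF step(2,5)] app[OF step(3,5)] R[OF step(1-3)] by metis
  qed auto
  define h where "h U = ?e (SOME w. w \<in> U)" for U
  have h: "h (word_class A R w) = ?e w" if "w \<in> lists A" for w
  proof -
    have "w \<in> word_class A R w" using that by (auto intro: word_cong.refl)
    then have "(SOME u. u \<in> word_class A R w) \<in> word_class A R w" by (rule someI)
    then have "(w, SOME u. u \<in> word_class A R w) \<in> word_cong A R" by simp
    then show ?thesis unfolding h_def by (rule cong [symmetric])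
  qed
  have "h \<in> hom (word_quotient A R) H"
  proof (rule homI)
    fix U assume "U \<in> carrier (word_quotient A R)"
    then obtain u where u: "u \<in> lists A" "U = word_class A R u"
      by (rule word_quotient_carrierE)
    then show "h U \<in> carrier H" using h closed by (simp add: H.list_prod_closed)
    fix V assume "V \<in> carrier (word_quotient A R)"
    then obtain v where v: "v \<in> lists A" "V = word_class A R v"
      by (rule word_quotient_carrierE)
    have "h (word_class A R (u @ v)) = h U \<otimes>\<^bsub>H\<^esub> h V"
      using u v h app by (simp del: in_lists_conv_set)
    then show "h (U \<otimes>\<^bsub>word_quotient A R\<^esub> V) = h U \<otimes>\<^bsub>H\<^esub> h V"
      using u v by (simp add: word_quotient_mult del: in_lists_conv_set)
  qed
  moreover have "h (word_class A R [a]) = f a" if "a \<in> A" for a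
    using h[of "[a]"] f that by simp
  ultimately show ?thesis using that by blast
qed

text \<open>The classes of single letters generate the quotient already as a monoid, so induction on
  words suffices. Surjectivity and uniqueness of homomorphisms are derived from this.\<close>

lemma word_quotient_hom_image_subset:
  assumes "group (word_quotient A R)" "group H" and h: "h \<in> hom (word_quotient A R) H"
    and K: "subgroup K H" "\<And>a. a \<in> A \<Longrightarrow> h (word_class A R [a]) \<in> K"
  shows "h ` carrier (word_quotient A R) \<subseteq> K"
proof -
  interpret group_hom "word_quotient A R" H h
    using assms by (simp add: group_hom_def group_hom_axioms_def)
  have "h (word_class A R w) \<in> K" if "w \<in> lists A" for w
    using that
  proof (induction w)
    case Nil
    then show ?case
      using hom_one subgroup.one_closed[OF K(1)] by (simp add: word_quotient_one)
  next
    case (Cons a w)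
    have "h (word_class A R (a # w)) = h (word_class A R [a]) \<otimes>\<^bsub>H\<^esub> h (word_class A R w)"
      unfolding word_class_Cons[OF Cons(1,2)] using Cons(1,2)
      by (intro hom_mult word_class_in_carrier) auto
    then show ?case
      using subgroup.m_closed[OF K(1) K(2)[OF Cons(1)] Cons(3)] by (simp only:)
  qed
  then show ?thesis by (auto elim!: word_quotient_carrierE)
qed

section \<open>Free groups\<close>

definition free_group_rels :: "'x set \<Rightarrow> (('x \<times> bool) list \<times> ('x \<times> bool) list) set" where
  "free_group_rels X = {([(x, b), (x, \<not> b)], []) | x b. x \<in> X}"

lemma free_group_eq: "free_group X = word_quotient (X \<times> UNIV) (free_group_rels X)"
  by (simp add: free_group_def free_group_rels_def)

definition free_gen :: "'x set \<Rightarrow> 'x \<Rightarrow> ('x \<times> bool) list set" where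
  "free_gen X x = word_class (X \<times> UNIV) (free_group_rels X) [(x, True)]"

lemma free_gen_closed: "x \<in> X \<Longrightarrow> free_gen X x \<in> carrier (free_group X)"
  unfolding free_gen_def free_group_eq by (rule word_class_in_carrier) simp

text \<open>Identifies the negative letters, so that later conditions have to be checked on the
  generators \<open>free_gen X x\<close> only.\<close>

lemma inv_free_gen:
  assumes "x \<in> X"
  shows "inv\<^bsub>free_group X\<^esub> free_gen X x =
    word_class (X \<times> UNIV) (free_group_rels X) [(x, False)]"
proof -
  let ?A = "X \<times> (UNIV :: bool set)" and ?R = "free_group_rels X"
  interpret group "free_group X" by (rule free_group_is_group)
  have "([(x, False), (x, \<not> False)], []) \<in> ?R"
    using assms unfolding free_group_rels_def by blast
  then have "([(x, False), (x, True)], []) \<in> word_cong ?A ?R"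
    using assms by (intro word_cong_basic) auto
  then have "word_class ?A ?R [(x, False), (x, True)] = word_class ?A ?R []"
    by (rule word_class_eq)
  then have "word_class ?A ?R [(x, False)] \<otimes>\<^bsub>free_group X\<^esub> free_gen X x = \<one>\<^bsub>free_group X\<^esub>"
    using assms word_quotient_mult[of "[(x, False)]" ?A "[(x, True)]" ?R]
    by (simp add: free_group_eq free_gen_def word_quotient_one)
  then show ?thesis
    using assms by (intro inv_equality free_gen_closed)
      (auto simp: free_group_eq intro!: word_class_in_carrier)
qed

lemma free_group_lift:
  assumes H: "group H" and f: "\<And>x. x \<in> X \<Longrightarrow> f x \<in> carrier H"
  obtains h where "h \<in> hom (free_group X) H" "\<And>x. x \<in> X \<Longrightarrow> h (free_gen X x) = f x"
proof -
  interpret H: group H by fact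
  let ?g = "\<lambda>(x, b). if b then f x else inv\<^bsub>H\<^esub> f x"
  obtain h where "h \<in> hom (free_group X) H"
    "\<And>a. a \<in> X \<times> UNIV \<Longrightarrow>
      h (word_class (X \<times> UNIV) (free_group_rels X) [a]) = ?g a"
    unfolding free_group_eq
    by (rule word_quotient_lift[OF H, of "X \<times> (UNIV :: bool set)" ?g "free_group_rels X"])
      (use f in \<open>auto simp: free_group_rels_def\<close>)
  then show ?thesis using that by (auto simp: free_gen_def)
qed

lemma free_group_hom_image_subset:
  assumes "group H" "h \<in> hom (free_group X) H" "subgroup K H"
    "\<And>x. x \<in> X \<Longrightarrow> h (free_gen X x) \<in> K"
  shows "h ` carrier (free_group X) \<subseteq> K"
proof -
  interpret group_hom "free_group X" H h
    using assms free_group_is_group by (simp add: group_hom_def group_hom_axioms_def)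
  have "h (inv\<^bsub>free_group X\<^esub> free_gen X x) \<in> K" if "x \<in> X" for x
    using that assms free_gen_closed[OF that] by (simp add: subgroup.m_inv_closed)
  then have "h (word_class (X \<times> UNIV) (free_group_rels X) [(x, False)]) \<in> K" if "x \<in> X" for x
    using that inv_free_gen[OF that] by metis
  then have "h (word_class (X \<times> UNIV) (free_group_rels X) [a]) \<in> K"
    if "a \<in> X \<times> UNIV" for a
    using that assms(4) by (cases "snd a") (auto simp: free_gen_def)
  then show ?thesis
    using word_quotient_hom_image_subset[OF _ assms(1), of "X \<times> UNIV" _ h K] assms
      free_group_is_group[of X] unfolding free_group_eq by blast
qed

text \<open>Two homomorphisms agree if their graph, as a map into \<open>H \<times>\<times> H\<close>, lies in the diagonal.\<close>

lemma free_group_hom_eq: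
  assumes H: "group H" and h: "h \<in> hom (free_group X) H" "k \<in> hom (free_group X) H"
    and eq: "\<And>x. x \<in> X \<Longrightarrow> h (free_gen X x) = k (free_gen X x)"
    and a: "a \<in> carrier (free_group X)"
  shows "h a = k a"
proof -
  interpret H: group H by fact
  let ?D = "{(y, y) | y. y \<in> carrier H}"
  interpret HH: group "H \<times>\<times> H" using H H by (rule DirProd_group)
  have "subgroup ?D (H \<times>\<times> H)"
    by (rule HH.subgroupI) (auto simp: inv_DirProd[OF H H])
  moreover have "(\<lambda>a. (h a, k a)) \<in> hom (free_group X) (H \<times>\<times> H)"
    using h by (simp add: hom_paired)
  ultimately have "(\<lambda>a. (h a, k a)) ` carrier (free_group X) \<subseteq> ?D"
    using eq hom_in_carrier[OF h(2) free_gen_closed]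
    by (intro free_group_hom_image_subset[OF HH.is_group]) auto
  then show ?thesis using a by auto
qed

section \<open>Free products\<close>

lemma free_product_lift:
  assumes groups: "group G" "group H" "group P" and i: "i \<in> hom G P" and j: "j \<in> hom H P"
  obtains h where "h \<in> hom (free_product G H) P"
    "\<And>g. g \<in> carrier G \<Longrightarrow> h (free_product_inl G H g) = i g"
    "\<And>g. g \<in> carrier H \<Longrightarrow> h (free_product_inr G H g) = j g"
proof -
  interpret i: group_hom G P i using groups i by (simp add: group_hom_def group_hom_axioms_def)
  interpret j: group_hom H P j using groups j by (simp add: group_hom_def group_hom_axioms_def)
  obtain h where h: "h \<in> hom (free_product G H) P"
    "\<And>a. a \<in> carrier G <+> carrier H \<Longrightarrow>
      h (word_class (carrier G <+> carrier H) (free_product_rels G H) [a]) = case_sum i j a"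
    unfolding free_product_def
    by (rule word_quotient_lift[OF groups(3), of "carrier G <+> carrier H" "case_sum i j"
        "free_product_rels G H"]) (auto simp: free_product_rels_def)
  then show ?thesis
    using that[OF h(1)] by (simp add: free_product_inl_def free_product_inr_def InlI InrI)
qed

lemma free_product_hom_image_subset:
  assumes groups: "group G" "group H" "group P" and h: "h \<in> hom (free_product G H) P"
    and K: "subgroup K P" "\<And>g. g \<in> carrier G \<Longrightarrow> h (free_product_inl G H g) \<in> K"
      "\<And>g. g \<in> carrier H \<Longrightarrow> h (free_product_inr G H g) \<in> K"
  shows "h ` carrier (free_product G H) \<subseteq> K"
  using free_product_is_group[OF groups(1,2)] h K(2,3)
  unfolding free_product_def free_product_inl_def free_product_inr_def
  by (intro word_quotient_hom_image_subset[OF _ groups(3) _ K(1)]) auto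


section \<open>Weak commutativity groups\<close>

lemma hom_commutator:
  assumes "group F" "group G" "\<phi> \<in> hom F G" "x \<in> carrier F" "y \<in> carrier F"
  shows "\<phi> (commutator F x y) = commutator G (\<phi> x) (\<phi> y)"
proof -
  interpret group_hom F G \<phi>
    using assms by (simp add: group_hom_def group_hom_axioms_def)
  show ?thesis using assms by (simp add: commutator_def)
qed

context group
begin

lemma commutator_eq_one_iff:
  assumes "x \<in> carrier G" "y \<in> carrier G"
  shows "commutator G x y = \<one> \<longleftrightarrow> x \<otimes> y = y \<otimes> x"
proof -
  have "commutator G x y = (x \<otimes> y) \<otimes> inv (y \<otimes> x)"
    using assms by (simp add: commutator_def m_assoc inv_mult_group)
  then have "commutator G x y = \<one> \<longleftrightarrow> (x \<otimes> y) \<otimes> inv (y \<otimes> x) = (y \<otimes> x) \<otimes> inv (y \<otimes> x)"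
    using assms by simp
  also have "\<dots> \<longleftrightarrow> x \<otimes> y = y \<otimes> x"
    using assms by (intro right_cancel) auto
  finally show ?thesis .
qed

lemma commutator_closed:
  "x \<in> carrier G \<Longrightarrow> y \<in> carrier G \<Longrightarrow> commutator G x y \<in> carrier G"
  by (simp add: commutator_def)

lemma subgroup_word_balls:
  assumes A: "A \<subseteq> carrier G" "(\<lambda>x. inv x) ` A \<subseteq> A"
  shows "subgroup (\<Union>n. word_ball G A n) G"
proof (rule subgroupI)
  show "(\<Union>n. word_ball G A n) \<subseteq> carrier G"
    using word_ball_closed[OF A(1)] by blast
  show "(\<Union>n. word_ball G A n) \<noteq> {}"
    using word_ballI[of "[]" A 0 G] by auto
  show "inv x \<in> (\<Union>n. word_ball G A n)" if "x \<in> (\<Union>n. word_ball G A n)" for x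
    using that word_ball_inv[OF A] by blast
  show "x \<otimes> y \<in> (\<Union>n. word_ball G A n)"
    if "x \<in> (\<Union>n. word_ball G A n)" "y \<in> (\<Union>n. word_ball G A n)" for x y
    using that word_ball_mult[OF A(1) _ _ order.refl] by blast
qed

end

text \<open>Supplies the finite inverse-closed generating set that \<open>commuting_all\<close> asks
  for: the images of the free generators together with their inverses.\<close>

lemma word_balls_free_group_image:
  assumes G: "group G" and X: "finite X"
    and \<phi>: "\<phi> \<in> hom (free_group X) G" "\<phi> ` carrier (free_group X) = carrier G"
  obtains A where "finite A" "A \<subseteq> carrier G" "(\<lambda>x. inv\<^bsub>G\<^esub> x) ` A \<subseteq> A"
    "\<And>g. g \<in> carrier G \<Longrightarrow> \<exists>n. g \<in> word_ball G A n"
proof -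
  interpret G: group G by fact
  define B where "B = (\<lambda>x. \<phi> (free_gen X x)) ` X"
  define A where "A = B \<union> (\<lambda>x. inv\<^bsub>G\<^esub> x) ` B"
  have B: "B \<subseteq> carrier G"
    using hom_in_carrier[OF \<phi>(1) free_gen_closed] by (auto simp: B_def)
  then have A: "A \<subseteq> carrier G" "(\<lambda>x. inv\<^bsub>G\<^esub> x) ` A \<subseteq> A"
    by (auto simp: A_def subset_iff)
  have "\<phi> ` carrier (free_group X) \<subseteq> (\<Union>n. word_ball G A n)"
  proof (rule free_group_hom_image_subset[OF G \<phi>(1) G.subgroup_word_balls[OF A]])
    fix x assume "x \<in> X"
    then have "\<phi> (free_gen X x) \<in> A" by (auto simp: A_def B_def)
    then show "\<phi> (free_gen X x) \<in> (\<Union>n. word_ball G A n)"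
      using word_ballI[of "[\<phi> (free_gen X x)]" A 1 G] A(1) by (auto simp: subset_iff)
  qed
  then have "\<exists>n. g \<in> word_ball G A n" if "g \<in> carrier G" for g
    using that \<phi>(2) by blast
  moreover have "finite A" using X by (simp add: A_def B_def)
  ultimately show ?thesis using that A by blast
qed

text \<open>Through \<open>\<rho>\<close>, the group \<open>G\<close> arises from \<open>H\<close>
  by identifying each generator with its image under \<open>\<sigma> \<circ> \<rho>\<close>. Hence
  one additional relator per generator of \<open>H\<close> is enough.\<close>

lemma finitely_presented_retract:
  assumes groups: "group H" "group G" and fp: "finitely_presented H"
    and \<rho>: "\<rho> \<in> hom H G" and \<sigma>: "\<sigma> \<in> hom G H" "\<And>g. g \<in> carrier G \<Longrightarrow> \<rho> (\<sigma> g) = g"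
  shows "finitely_presented G"
proof -
  obtain X :: "nat set" and R \<phi> where X: "finite X" "finite R" and pres: "presents (free_group X) R \<phi> H"
    using fp finitely_presented_iff_presents[OF groups(1)] by blast
  let ?F = "free_group X"
  note p = presentsD[OF pres]
  interpret F: group ?F by (rule free_group_is_group)
  interpret \<phi>: group_hom ?F H \<phi>
    using groups p(1) F.is_group by (simp add: group_hom_def group_hom_axioms_def)
  interpret \<rho>: group_hom H G \<rho>
    using groups \<rho> by (simp add: group_hom_def group_hom_axioms_def)
  \<comment> \<open>A word in the generators of \<open>H\<close> that represents the retracted
    generator.\<close>
  define t where "t x = (SOME a. a \<in> carrier ?F \<and> \<phi> a = \<sigma> (\<rho> (\<phi> (free_gen X x))))" for x
  have t: "t x \<in> carrier ?F" "\<phi> (t x) = \<sigma> (\<rho> (\<phi> (free_gen X x)))" if "x \<in> X" for x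
  proof -
    have "\<sigma> (\<rho> (\<phi> (free_gen X x))) \<in> \<phi> ` carrier ?F"
      unfolding p(2) using that free_gen_closed[OF that] by (intro hom_in_carrier[OF \<sigma>(1)]) simp
    then have "\<exists>a. a \<in> carrier ?F \<and> \<phi> a = \<sigma> (\<rho> (\<phi> (free_gen X x)))" by auto
    from someI_ex[OF this] show "t x \<in> carrier ?F" "\<phi> (t x) = \<sigma> (\<rho> (\<phi> (free_gen X x)))"
      by (auto simp: t_def)
  qed
  define R' where "R' = R \<union> (\<lambda>x. free_gen X x \<otimes>\<^bsub>?F\<^esub> inv\<^bsub>?F\<^esub> t x) ` X"
  have R': "R' \<subseteq> carrier ?F" "finite R'"
    using p(3) X t free_gen_closed[of _ X] by (auto simp: R'_def)
  let ?q = "r_coset ?F (normal_closure ?F R')"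
  let ?Q = "?F Mod normal_closure ?F R'"
  interpret Q: group ?Q
    using F.is_group R'(1) by (rule group_quotient_normal_closure)
  have presQ: "presents ?F R' ?q ?Q"
    using F.is_group R'(1) by (rule presents_quotient)
  interpret q: group_hom ?F ?Q ?q
    using presentsD(1)[OF presQ] F.is_group Q.is_group
    by (simp add: group_hom_def group_hom_axioms_def)
  \<comment> \<open>The old relators are among the new ones, so the projection to \<open>?Q\<close>
    factors through \<open>H\<close>.\<close>
  have "?q r = \<one>\<^bsub>?Q\<^esub>" if "r \<in> R" for r
    using that presents_relator[OF presQ] by (simp add: R'_def)
  then obtain \<psi> where \<psi>: "\<psi> \<in> hom H ?Q" "\<And>a. a \<in> carrier ?F \<Longrightarrow> \<psi> (\<phi> a) = ?q a"
    using presents_lift[OF F.is_group groups(1) Q.is_group pres presentsD(1)[OF presQ]] by metis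
  have "presents ?F R' (\<rho> \<circ> \<phi>) G"
  proof (rule presentsI[OF F.is_group groups(2) _ _ R'(1)])
    show hom: "\<rho> \<circ> \<phi> \<in> hom ?F G" using p(1) \<rho> by (rule hom_compose)
    have "\<rho> ` carrier H = carrier G"
      using \<sigma> hom_in_carrier[OF \<sigma>(1)] hom_carrier[OF \<rho>] by force
    then show "(\<rho> \<circ> \<phi>) ` carrier ?F = carrier G" by (simp only: image_comp [symmetric] p(2))
    show "(\<rho> \<circ> \<phi>) r = \<one>\<^bsub>G\<^esub>" if "r \<in> R'" for r
      using that unfolding R'_def
    proof
      assume "r \<in> R"
      then show ?thesis using presents_relator[OF pres] by simp
    next
      assume "r \<in> (\<lambda>x. free_gen X x \<otimes>\<^bsub>?F\<^esub> inv\<^bsub>?F\<^esub> t x) ` X"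
      then obtain x where x: "x \<in> X" "r = free_gen X x \<otimes>\<^bsub>?F\<^esub> inv\<^bsub>?F\<^esub> t x" by blast
      have "\<rho> (\<phi> (t x)) = \<rho> (\<phi> (free_gen X x))"
        using t[OF x(1)] \<sigma>(2) free_gen_closed[OF x(1)] by simp
      then show ?thesis using x t(1)[OF x(1)] free_gen_closed[OF x(1)] by simp
    qed
    show "\<psi> \<circ> \<sigma> \<in> hom G ?Q" using \<sigma>(1) \<psi>(1) by (rule hom_compose)
    then have comp: "\<psi> \<circ> \<sigma> \<circ> (\<rho> \<circ> \<phi>) \<in> hom ?F ?Q" using hom by (rule hom_compose[rotated])
    \<comment> \<open>On a generator \<open>x\<close> the left side is \<open>?q (t x)\<close> by
      the choice of \<open>t\<close>, and the added relator equates this with the class of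
      \<open>x\<close>.\<close>
    have "(\<psi> \<circ> \<sigma> \<circ> (\<rho> \<circ> \<phi>)) a = ?q a" if "a \<in> carrier ?F" for a
    proof (rule free_group_hom_eq[OF Q.is_group comp presentsD(1)[OF presQ] _ that])
      fix x assume x: "x \<in> X"
      let ?g = "free_gen X x"
      have "?q (?g \<otimes>\<^bsub>?F\<^esub> inv\<^bsub>?F\<^esub> t x) = \<one>\<^bsub>?Q\<^esub>"
        using presents_relator[OF presQ, of "?g \<otimes>\<^bsub>?F\<^esub> inv\<^bsub>?F\<^esub> t x"] x unfolding R'_def by blast
      then have "?q ?g \<otimes>\<^bsub>?Q\<^esub> inv\<^bsub>?Q\<^esub> ?q (t x) = ?q (t x) \<otimes>\<^bsub>?Q\<^esub> inv\<^bsub>?Q\<^esub> ?q (t x)"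
        using t(1)[OF x] free_gen_closed[OF x] q.hom_mult q.hom_inv Q.r_inv q.hom_closed
        by (metis F.inv_closed)
      then have "?q ?g = ?q (t x)"
        using t(1)[OF x] free_gen_closed[OF x] Q.right_cancel q.hom_closed Q.inv_closed by metis
      then show "(\<psi> \<circ> \<sigma> \<circ> (\<rho> \<circ> \<phi>)) ?g = ?q ?g"
        using \<psi>(2)[OF t(1)[OF x]] t(2)[OF x] by simp
    qed
    then show "(\<psi> \<circ> \<sigma>) ((\<rho> \<circ> \<phi>) a) = ?q a" if "a \<in> carrier ?F" for a using that by simp
  qed
  then show ?thesis
    using finitely_presented_iff_presents[OF groups(2)] X R'(2) by blast
qed

section \<open>The weak commutativity group: universal property and finite presentations\<close>

context group
begin

abbreviation copy :: "'a \<Rightarrow> ('a + 'a) list set" where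
  "copy \<equiv> free_product_inr G G"

abbreviation weak_rels :: "('a + 'a) list set set" where
  "weak_rels \<equiv> {commutator (free_product G G) (free_product_inl G G g) (copy g) | g. g \<in> carrier G}"

lemma weak_rels_closed: "weak_rels \<subseteq> carrier (free_product G G)"
proof -
  interpret P: group "free_product G G" by (rule free_product_is_group[OF is_group is_group])
  show ?thesis
    by (auto intro!: P.commutator_closed hom_in_carrier[OF free_product_inl_hom[OF is_group]]
        hom_in_carrier[OF free_product_inr_hom[OF is_group]])
qed

definition weak_proj :: "('a + 'a) list set \<Rightarrow> ('a + 'a) list set set" where
  "weak_proj = r_coset (free_product G G) (normal_closure (free_product G G) weak_rels)"

lemma presents_weak_commutativity_group:
  "presents (free_product G G) weak_rels weak_proj (weak_commutativity_group G)"
  unfolding weak_proj_def weak_commutativity_group_def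
  using free_product_is_group[OF is_group is_group] weak_rels_closed by (rule presents_quotient)

lemma weak_commutativity_group_is_group: "group (weak_commutativity_group G)"
  unfolding weak_commutativity_group_def
  using free_product_is_group[OF is_group is_group] weak_rels_closed
  by (rule group_quotient_normal_closure)

text \<open>The homomorphism that \<open>i\<close> and \<open>j\<close> induce on the free product
  sends each defining commutator to the commutator of \<open>i g\<close> and \<open>j g\<close>,
  which is trivial by assumption.\<close>

lemma weak_commutativity_lift:
  assumes P: "group P" and i: "i \<in> hom G P" and j: "j \<in> hom G P"
    and comm: "\<And>g. g \<in> carrier G \<Longrightarrow> i g \<otimes>\<^bsub>P\<^esub> j g = j g \<otimes>\<^bsub>P\<^esub> i g"
  obtains h where "h \<in> hom (weak_commutativity_group G) P"
    "\<And>g. g \<in> carrier G \<Longrightarrow> h (weak_proj (free_product_inl G G g)) = i g"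
    "\<And>g. g \<in> carrier G \<Longrightarrow> h (weak_proj (copy g)) = j g"
proof -
  note fp = free_product_is_group[OF is_group is_group]
  note inl = hom_in_carrier[OF free_product_inl_hom[OF is_group, of G]]
  note inr = hom_in_carrier[OF free_product_inr_hom[OF is_group, of G]]
  obtain k where k: "k \<in> hom (free_product G G) P"
    "\<And>g. g \<in> carrier G \<Longrightarrow> k (free_product_inl G G g) = i g"
    "\<And>g. g \<in> carrier G \<Longrightarrow> k (copy g) = j g"
    by (rule free_product_lift[OF is_group is_group P i j]) (rule that)
  have kr: "k r = \<one>\<^bsub>P\<^esub>" if "r \<in> weak_rels" for r
  proof -
    from that obtain g where g: "g \<in> carrier G"
      "r = commutator (free_product G G) (free_product_inl G G g) (copy g)" by blast
    have "k r = commutator P (i g) (j g)"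
      using hom_commutator[OF fp P k(1) inl[OF g(1)] inr[OF g(1)]]
      unfolding g(2) k(2,3)[OF g(1)] .
    also have "\<dots> = \<one>\<^bsub>P\<^esub>"
      using comm[OF g(1)] group.commutator_eq_one_iff[OF P hom_in_carrier[OF i g(1)]
        hom_in_carrier[OF j g(1)]] by blast
    finally show ?thesis .
  qed
  obtain h where h: "h \<in> hom (weak_commutativity_group G) P"
    "\<And>a. a \<in> carrier (free_product G G) \<Longrightarrow> h (weak_proj a) = k a"
    by (rule presents_lift[OF fp weak_commutativity_group_is_group P
        presents_weak_commutativity_group k(1)]) (erule kr, rule that)
  show ?thesis
  proof (rule that[OF h(1)])
    fix g assume g: "g \<in> carrier G"
    show "h (weak_proj (free_product_inl G G g)) = i g"
      using h(2)[OF inl[OF g]] k(2)[OF g] by (rule HOL.trans)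
    show "h (weak_proj (copy g)) = j g"
      using h(2)[OF inr[OF g]] k(3)[OF g] by (rule HOL.trans)
  qed
qed

lemma weak_proj_inl_hom: "weak_proj \<circ> free_product_inl G G \<in> hom G (weak_commutativity_group G)"
  using free_product_inl_hom[OF is_group, of G] presentsD(1)[OF presents_weak_commutativity_group]
  by (rule Group.hom_compose)

lemma weak_proj_inr_hom: "weak_proj \<circ> copy \<in> hom G (weak_commutativity_group G)"
  using free_product_inr_hom[OF is_group, of G] presentsD(1)[OF presents_weak_commutativity_group]
  by (rule Group.hom_compose)

lemma weak_proj_commute:
  assumes "g \<in> carrier G"
  shows "commutator (weak_commutativity_group G) (weak_proj (free_product_inl G G g))
    (weak_proj (copy g)) = \<one>\<^bsub>weak_commutativity_group G\<^esub>"
proof -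
  note fp = free_product_is_group[OF is_group is_group]
  have "weak_proj (commutator (free_product G G) (free_product_inl G G g) (copy g))
      = \<one>\<^bsub>weak_commutativity_group G\<^esub>"
    using assms by (intro presents_relator[OF presents_weak_commutativity_group]) blast
  moreover have "weak_proj (commutator (free_product G G) (free_product_inl G G g) (copy g))
      = commutator (weak_commutativity_group G) (weak_proj (free_product_inl G G g))
        (weak_proj (copy g))"
    by (rule hom_commutator[OF fp weak_commutativity_group_is_group
          presentsD(1)[OF presents_weak_commutativity_group]
          hom_in_carrier[OF free_product_inl_hom[OF is_group] assms]
          hom_in_carrier[OF free_product_inr_hom[OF is_group] assms]])
  ultimately show ?thesis by (simp only:)
qed

lemma weak_commutativity_subgroup_top:
  assumes K: "subgroup K (weak_commutativity_group G)"
    and "\<And>g. g \<in> carrier G \<Longrightarrow> weak_proj (free_product_inl G G g) \<in> K"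
    and "\<And>g. g \<in> carrier G \<Longrightarrow> weak_proj (copy g) \<in> K"
  shows "K = carrier (weak_commutativity_group G)"
proof
  show "K \<subseteq> carrier (weak_commutativity_group G)" using K by (rule subgroup.subset)
  show "carrier (weak_commutativity_group G) \<subseteq> K"
    unfolding presentsD(2)[OF presents_weak_commutativity_group, symmetric]
    by (rule free_product_hom_image_subset[OF is_group is_group weak_commutativity_group_is_group
          presentsD(1)[OF presents_weak_commutativity_group] assms])
qed

text \<open>The presentation has two copies of the generators and of the relators of
  \<open>G\<close>, and one commutator for each element of the ball of radius
  \<open>2 * card A + 2\<close>. In the group \<open>?Q\<close> so presented
  \<open>commuting_all\<close> yields all remaining commutation relations; this gives a map from
  \<open>?W\<close> to \<open>?Q\<close>, and \<open>presentsI\<close> applies.\<close>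

lemma finitely_presented_imp_weak_commutativity:
  assumes "finitely_presented G"
  shows "finitely_presented (weak_commutativity_group G)"
proof -
  let ?W = "weak_commutativity_group G"
  interpret W: group ?W by (rule weak_commutativity_group_is_group)
  obtain X :: "nat set" and R \<phi> where X: "finite X" "finite R"
    and pres: "presents (free_group X) R \<phi> G"
    using assms finitely_presented_iff_presents[OF is_group] by blast
  let ?F = "free_group X"
  note p = presentsD[OF pres]
  interpret F: group ?F by (rule free_group_is_group)
  obtain A where A: "finite A" "A \<subseteq> carrier G" "(\<lambda>x. inv x) ` A \<subseteq> A"
    "\<And>g. g \<in> carrier G \<Longrightarrow> \<exists>n. g \<in> word_ball G A n"
    by (rule word_balls_free_group_image[OF is_group X(1) p(1,2)]) (rule that)
  let ?B = "word_ball G A (2 * card A + 2)"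
  have B: "?B \<subseteq> carrier G" using A(2) by (rule word_ball_closed)
  \<comment> \<open>A set-theoretic section of \<open>\<phi>\<close>: relators must be words, while
    the ball consists of elements of \<open>G\<close>.\<close>
  define s where "s g = (SOME a. a \<in> carrier ?F \<and> \<phi> a = g)" for g
  have s: "s g \<in> carrier ?F" "\<phi> (s g) = g" if "g \<in> carrier G" for g
  proof -
    from that have "g \<in> \<phi> ` carrier ?F" by (simp only: p(2))
    then have "\<exists>a. a \<in> carrier ?F \<and> \<phi> a = g" by blast
    then have "s g \<in> carrier ?F \<and> \<phi> (s g) = g" unfolding s_def by (rule someI_ex)
    then show "s g \<in> carrier ?F" "\<phi> (s g) = g" by blast+
  qed
  \<comment> \<open>Generators of \<open>G\<close> are even, those of its copy odd.\<close>
  define Y where "Y = (\<lambda>x. 2 * x) ` X \<union> (\<lambda>x. Suc (2 * x)) ` X"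
  let ?E = "free_group Y"
  interpret E: group ?E by (rule free_group_is_group)
  have Y: "2 * x \<in> Y" "Suc (2 * x) \<in> Y" if "x \<in> X" for x using that by (auto simp: Y_def)
  obtain \<alpha> where \<alpha>: "\<alpha> \<in> hom ?F ?E" "\<And>x. x \<in> X \<Longrightarrow> \<alpha> (free_gen X x) = free_gen Y (2 * x)"
    by (rule free_group_lift[OF E.is_group, of X "\<lambda>x. free_gen Y (2 * x)"])
      (erule free_gen_closed[OF Y(1)], rule that)
  obtain \<beta> where \<beta>: "\<beta> \<in> hom ?F ?E" "\<And>x. x \<in> X \<Longrightarrow> \<beta> (free_gen X x) = free_gen Y (Suc (2 * x))"
    by (rule free_group_lift[OF E.is_group, of X "\<lambda>x. free_gen Y (Suc (2 * x))"])
      (erule free_gen_closed[OF Y(2)], rule that)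
  define \<iota> where "\<iota> = weak_proj \<circ> free_product_inl G G"
  define \<kappa> where "\<kappa> = weak_proj \<circ> copy"
  have \<iota>: "\<iota> \<in> hom G ?W" and \<kappa>: "\<kappa> \<in> hom G ?W"
    using weak_proj_inl_hom weak_proj_inr_hom by (simp_all add: \<iota>_def \<kappa>_def)
  \<comment> \<open>Parity tells which copy a generator belongs to, and \<open>n div 2\<close>
    recovers the index in \<open>X\<close> in both cases.\<close>
  let ?f = "\<lambda>n. if even n then \<iota> (\<phi> (free_gen X (n div 2))) else \<kappa> (\<phi> (free_gen X (n div 2)))"
  have f: "?f y \<in> carrier ?W" if "y \<in> Y" for y
  proof -
    from that obtain x where x: "x \<in> X" "y = 2 * x \<or> y = Suc (2 * x)"
      unfolding Y_def by blast
    note xc = hom_in_carrier[OF p(1) free_gen_closed[OF x(1)]]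
    have "y div 2 = x" using x(2) by auto
    then show ?thesis
      using hom_in_carrier[OF \<iota> xc] hom_in_carrier[OF \<kappa> xc] by simp
  qed
  obtain \<Phi> where \<Phi>: "\<Phi> \<in> hom ?E ?W" "\<And>y. y \<in> Y \<Longrightarrow> \<Phi> (free_gen Y y) = ?f y"
    by (rule free_group_lift[OF W.is_group, of Y ?f]) (erule f, rule that)
  interpret \<Phi>: group_hom ?E ?W \<Phi>
    using \<Phi>(1) E.is_group W.is_group by (simp add: group_hom_def group_hom_axioms_def)
  have \<Phi>\<alpha>: "\<Phi> (\<alpha> a) = \<iota> (\<phi> a)" if "a \<in> carrier ?F" for a
  proof -
    have "(\<Phi> \<circ> \<alpha>) a = (\<iota> \<circ> \<phi>) a"
      by (rule free_group_hom_eq[OF W.is_group Group.hom_compose[OF \<alpha>(1) \<Phi>(1)]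
            Group.hom_compose[OF p(1) \<iota>] _ that]) (simp add: \<alpha>(2) \<Phi>(2) Y)
    then show ?thesis by simp
  qed
  have \<Phi>\<beta>: "\<Phi> (\<beta> a) = \<kappa> (\<phi> a)" if "a \<in> carrier ?F" for a
  proof -
    have "(\<Phi> \<circ> \<beta>) a = (\<kappa> \<circ> \<phi>) a"
      by (rule free_group_hom_eq[OF W.is_group Group.hom_compose[OF \<beta>(1) \<Phi>(1)]
            Group.hom_compose[OF p(1) \<kappa>] _ that]) (simp add: \<beta>(2) \<Phi>(2) Y)
    then show ?thesis by simp
  qed
  note \<alpha>c = hom_in_carrier[OF \<alpha>(1)] and \<beta>c = hom_in_carrier[OF \<beta>(1)]
  \<comment> \<open>Finite because the ball is finite; one word \<open>s g\<close> per element
    \<open>g\<close> is enough, as \<open>\<alpha>\<close> R\<open>and\<close>\<beta>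
    \<open>R\<close> impose the relations of \<open>G\<close> on both copies.\<close>
  define T where "T = \<alpha> ` R \<union> \<beta> ` R \<union> (\<lambda>g. commutator ?E (\<alpha> (s g)) (\<beta> (s g))) ` ?B"
  have T: "T \<subseteq> carrier ?E"
    unfolding T_def using p(3) B by (auto intro!: E.commutator_closed \<alpha>c \<beta>c s(1))
  have finT: "finite T" using X(2) A(1) by (simp add: T_def finite_word_ball)
  let ?q = "r_coset ?E (normal_closure ?E T)"
  let ?Q = "?E Mod normal_closure ?E T"
  interpret Q: group ?Q using E.is_group T by (rule group_quotient_normal_closure)
  have presQ: "presents ?E T ?q ?Q" using E.is_group T by (rule presents_quotient)
  note q = presentsD(1)[OF presQ]
  have "\<alpha> r \<in> T" "\<beta> r \<in> T" if "r \<in> R" for r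
    using that by (auto simp: T_def)
  then have q1: "(?q \<circ> \<alpha>) r = \<one>\<^bsub>?Q\<^esub>" "(?q \<circ> \<beta>) r = \<one>\<^bsub>?Q\<^esub>" if "r \<in> R" for r
    using that presents_relator[OF presQ] unfolding comp_apply by blast+
  \<comment> \<open>The copy of \<open>R\<close> under \<open>\<alpha>\<close> dies in
    \<open>?Q\<close>, so \<open>G\<close> itself maps to \<open>?Q\<close>; likewise for
    \<open>\<beta>\<close> and \<open>j\<close>.\<close>
  obtain i where i: "i \<in> hom G ?Q" "\<And>a. a \<in> carrier ?F \<Longrightarrow> i (\<phi> a) = (?q \<circ> \<alpha>) a"
    by (rule presents_lift[OF F.is_group is_group Q.is_group pres
        Group.hom_compose[OF \<alpha>(1) q]]) (erule q1, rule that)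
  obtain j where j: "j \<in> hom G ?Q" "\<And>a. a \<in> carrier ?F \<Longrightarrow> j (\<phi> a) = (?q \<circ> \<beta>) a"
    by (rule presents_lift[OF F.is_group is_group Q.is_group pres
        Group.hom_compose[OF \<beta>(1) q]]) (erule q1, rule that)
  interpret ij: hom_pair G ?Q i j
    by unfold_locales (rule i j)+
  have "?B \<subseteq> ij.commuting"
  proof
    fix g assume g: "g \<in> ?B"
    then have gc: "g \<in> carrier G" using B by blast
    have eq: "i g = ?q (\<alpha> (s g))" "j g = ?q (\<beta> (s g))"
      using i(2)[OF s(1)[OF gc]] j(2)[OF s(1)[OF gc]] s(2)[OF gc] by simp_all
    have "?q (commutator ?E (\<alpha> (s g)) (\<beta> (s g))) = \<one>\<^bsub>?Q\<^esub>"
      using g by (intro presents_relator[OF presQ]) (simp add: T_def)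
    then have "commutator ?Q (i g) (j g) = \<one>\<^bsub>?Q\<^esub>"
      unfolding eq hom_commutator[OF E.is_group Q.is_group q \<alpha>c[OF s(1)[OF gc]] \<beta>c[OF s(1)[OF gc]]] .
    then show "g \<in> ij.commuting"
      using gc Q.commutator_eq_one_iff[OF ij.i.hom_closed ij.j.hom_closed, OF gc gc]
      unfolding ij.commuting_def by blast
  qed
  \<comment> \<open>The finitely many commutators in \<open>T\<close> force all the others.\<close>
  then have "ij.commuting = carrier G"
    using A by (intro ij.commuting_all) auto
  then have comm: "i g \<otimes>\<^bsub>?Q\<^esub> j g = j g \<otimes>\<^bsub>?Q\<^esub> i g" if "g \<in> carrier G" for g
    using that unfolding ij.commuting_def by blast
  obtain \<psi> where \<psi>: "\<psi> \<in> hom ?W ?Q"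
    "\<And>g. g \<in> carrier G \<Longrightarrow> \<psi> (weak_proj (free_product_inl G G g)) = i g"
    "\<And>g. g \<in> carrier G \<Longrightarrow> \<psi> (weak_proj (copy g)) = j g"
    by (rule weak_commutativity_lift[OF Q.is_group i(1) j(1)]) (erule comm, rule that)
  then have \<psi>': "\<psi> (\<iota> g) = i g" "\<psi> (\<kappa> g) = j g" if "g \<in> carrier G" for g
    using that by (simp_all add: \<iota>_def \<kappa>_def)
  have "presents ?E T \<Phi> ?W"
  proof (rule presentsI[OF E.is_group W.is_group \<Phi>(1) _ T _ \<psi>(1)])
    show "\<Phi> ` carrier ?E = carrier ?W"
    proof (rule weak_commutativity_subgroup_top[OF \<Phi>.img_is_subgroup])
      fix g assume g: "g \<in> carrier G"
      show "weak_proj (free_product_inl G G g) \<in> \<Phi> ` carrier ?E"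
        using \<Phi>\<alpha>[OF s(1)[OF g]] \<alpha>c[OF s(1)[OF g]] s(2)[OF g] unfolding \<iota>_def
        by (intro image_eqI[of _ _ "\<alpha> (s g)"]) simp_all
      show "weak_proj (copy g) \<in> \<Phi> ` carrier ?E"
        using \<Phi>\<beta>[OF s(1)[OF g]] \<beta>c[OF s(1)[OF g]] s(2)[OF g] unfolding \<kappa>_def
        by (intro image_eqI[of _ _ "\<beta> (s g)"]) simp_all
    qed
    show "\<Phi> r = \<one>\<^bsub>?W\<^esub>" if "r \<in> T" for r
    proof -
      from that consider a where "a \<in> R" "r = \<alpha> a" | a where "a \<in> R" "r = \<beta> a"
        | g where "g \<in> ?B" "r = commutator ?E (\<alpha> (s g)) (\<beta> (s g))"
        unfolding T_def by blast
      then show ?thesis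
      proof cases
        case 1
        show ?thesis
          using \<Phi>\<alpha>[OF subsetD[OF p(3) 1(1)]] 1(2)
          unfolding presents_relator[OF pres 1(1)] hom_one[OF \<iota> is_group W.is_group] by simp
      next
        case 2
        show ?thesis
          using \<Phi>\<beta>[OF subsetD[OF p(3) 2(1)]] 2(2)
          unfolding presents_relator[OF pres 2(1)] hom_one[OF \<kappa> is_group W.is_group] by simp
      next
        case 3
        then have g: "g \<in> carrier G" using B by blast
        show ?thesis
          using weak_proj_commute[OF g]
          unfolding 3(2) hom_commutator[OF E.is_group W.is_group \<Phi>(1) \<alpha>c[OF s(1)[OF g]]
              \<beta>c[OF s(1)[OF g]]] \<Phi>\<alpha>[OF s(1)[OF g]] \<Phi>\<beta>[OF s(1)[OF g]] s(2)[OF g]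
          by (simp add: \<iota>_def \<kappa>_def)
      qed
    qed
    show "\<psi> (\<Phi> a) = ?q a" if "a \<in> carrier ?E" for a
    proof -
      have "(\<psi> \<circ> \<Phi>) a = ?q a"
      proof (rule free_group_hom_eq[OF Q.is_group Group.hom_compose[OF \<Phi>(1) \<psi>(1)] q _ that])
        fix y assume y: "y \<in> Y"
        then consider x where "x \<in> X" "y = 2 * x" | x where "x \<in> X" "y = Suc (2 * x)"
          unfolding Y_def by blast
        then show "(\<psi> \<circ> \<Phi>) (free_gen Y y) = ?q (free_gen Y y)"
        proof cases
          case 1
          then show ?thesis
            using \<Phi>(2)[OF y] \<psi>'(1)[OF hom_in_carrier[OF p(1) free_gen_closed[OF 1(1)]]]
              i(2)[OF free_gen_closed[OF 1(1)]] \<alpha>(2)[OF 1(1)] by simp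
        next
          case 2
          then show ?thesis
            using \<Phi>(2)[OF y] \<psi>'(2)[OF hom_in_carrier[OF p(1) free_gen_closed[OF 2(1)]]]
              j(2)[OF free_gen_closed[OF 2(1)]] \<beta>(2)[OF 2(1)] by simp
        qed
      qed
      then show ?thesis by simp
    qed
  qed
  moreover have "finite Y" using X(1) by (simp add: Y_def)
  ultimately show ?thesis
    using finitely_presented_iff_presents[OF W.is_group] finT by blast
qed

text \<open>Folding both copies onto \<open>G\<close> by the identity is allowed because every
  element commutes with itself. The first copy is a section of this map, so \<open>G\<close> is a
  retract.\<close>

lemma weak_commutativity_imp_finitely_presented:
  assumes "finitely_presented (weak_commutativity_group G)"
  shows "finitely_presented G"
proof -
  have id: "id \<in> hom G G" by (auto simp: hom_def)
  obtain \<rho> where \<rho>: "\<rho> \<in> hom (weak_commutativity_group G) G"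
    "\<And>g. g \<in> carrier G \<Longrightarrow> \<rho> (weak_proj (free_product_inl G G g)) = id g"
    by (rule weak_commutativity_lift[OF is_group id id]) (rule HOL.refl, rule that)
  show ?thesis
    by (rule finitely_presented_retract[OF weak_commutativity_group_is_group is_group assms \<rho>(1)
          weak_proj_inl_hom]) (simp add: \<rho>(2))
qed

end

theorem theoremA:
  fixes G :: "('a, 'm) monoid_scheme"
  assumes "group G"
  shows "finitely_presented (weak_commutativity_group G) \<longleftrightarrow> finitely_presented G"
  using group.weak_commutativity_imp_finitely_presented[OF assms]
    group.finitely_presented_imp_weak_commutativity[OF assms] by blast

end
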